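(* Let $C$ be a closed convex cone in $H$, $K$ a nonempty closed convex subset of $C$ with $K^\infty$ pointed, and let $f:C\to H$ and $g:H\to H$ be weakly homogeneous mappings of degrees $\delta_1>0$ and $\delta_2>0$, respectively, written $f=f^\infty+\bar f+p$ and $g=g^\infty+\bar g+q$. Let $F,F^\infty:H\to H$ be any given continuous extensions of $f^\infty+\bar f-\bar f(0)$ and $f^\infty$, respectively. Suppose that $g^{-1}(C)\subseteq C$, that $\bar g(x)+q\in C$ as $\|x\|\to\infty$ (i.e. for all $x\in H$ with $\|x\|$ sufficiently large), and that there exists a vector $d\in\mathrm{int}((K^\infty)^* )$ such that one of the following conditions holds: (a) SOL$(f^\infty,g^\infty,K^\infty)=\{0\}=$ SOL$(f^\infty+\bar f-\bar f(0)+d,\,g,\,K^\infty)$, and there exists a nonempty bounded open set $\Omega\subset H$ satisfying $\mathrm{dist}(F(x),g(x))<\mathrm{dist}(d,\partial((K^\infty)^* ))$ for all $x\in\Omega$, such that $\deg(g,\Omega,0)\ne0$; (b) SOL$(f^\infty,g^\infty,K^\infty)=\{0\}=$ SOL$(f^\infty+d,\,g^\infty,\,K^\infty)$, and there exists a nonempty bounded open set $\Omega\subset H$ satisfying $\mathrm{dist}(F^\infty(x),g^\infty(x))<\mathrm{dist}(d,\partial((K^\infty)^* ))$ for all $x\in\Omega$, such that $\deg(g^\infty,\Omega,0)\ne0$. Then WHGVI$(f,g,K)$ and WHGCP$(f,g,K^\infty)$ have nonempty compact solution sets.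
   Context: $H$ is a finite dimensional real Hilbert space with inner product $\langle\cdot,\cdot\rangle$ and norm $\|\cdot\|$; $\mathrm{dist}(u,v)=\|u-v\|$ for points and $\mathrm{dist}(d,S)=\inf_{s\in S}\|d-s\|$ for a set $S$ (equal to $+\infty$ if $S=\emptyset$); $\mathrm{int}$ and $\partial$ denote interior and boundary; $g^{-1}(C)=\{x\in H\mid g(x)\in C\}$; the dual cone of $S$ is $S^*=\{u\in H\mid \langle u,x\rangle\ge0\ \forall x\in S\}$; the recession cone of $K$ is $K^\infty:=\{u\in H\mid \exists t_k\to\infty,\ \exists x^k\in K \text{ such that } x^k/t_k\to u\}$. Weakly homogeneous mappings: let $D\subseteq H$ be a closed convex cone ($D=C$ for $f$, $D=H$ for $g$). A continuous $h:D\to H$ is positively homogeneous of degree $\delta$ if $h(\lambda x)=\lambda^\delta h(x)$ for all $x\in D$, $\lambda>0$. A mapping $\varphi:D\to H$ is weakly homogeneous of degree $\delta>0$ if $\varphi=h+e$ with $h$ positively homogeneous of degree $\delta$ and $e:D\to H$ continuous with $e(x)/\|x\|^\delta\to0$ as $\|x\|\to\infty$ in $D$; $h$ is unique, is called the leading term and is denoted $\varphi^\infty$. In $f=f^\infty+\bar f+p$, $p\in H$ is the constant item and $\bar f:=f-f^\infty-p$; likewise $q\in H$ and $\bar g:=g-g^\infty-q$. Thus $\bar g+q=g-g^\infty$ and $f^\infty+\bar f-\bar f(0)=f-f(0)$. For mappings $\phi$ (on $C$ or $H$), $\psi:H\to H$ and closed convex $S$, SOL$(\phi,\psi,S)$ is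 the set of $x$ such that $\psi(x)\in S$ and $\langle\phi(x),y-\psi(x)\rangle\ge0$ for all $y\in S$; if $S$ is a cone this is equivalent to $\psi(x)\in S$, $\phi(x)\in S^*$, $\langle\phi(x),\psi(x)\rangle=0$. WHGVI$(f,g,K)$ is the problem with solution set SOL$(f,g,K)$, and WHGCP$(f,g,K^\infty)$ is the problem of finding $x\in H$ with $g(x)\in K^\infty$, $f(x)\in(K^\infty)^*$, $\langle f(x),g(x)\rangle=0$. $\deg(\phi,\Omega,b)$ is the topological (Brouwer) degree, defined when $\Omega$ is bounded open, $\phi$ is continuous on $\bar\Omega$ and $b\notin\phi(\partial\Omega)$; writing $\deg(\cdot)\ne0$ includes that it is defined. *)

theory Defs
  imports "HOL-Analysis.Analysis" "HOL-Homology.Homology"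
begin

section \<open>Cones\<close>

definition dual_cone :: "'a::real_inner set \<Rightarrow> 'a set" where
  "dual_cone S = {u. \<forall>x\<in>S. 0 \<le> u \<bullet> x}"

definition recession_cone :: "'a::real_normed_vector set \<Rightarrow> 'a set" where
  "recession_cone K =
     {u. \<exists>(t::nat \<Rightarrow> real) x. filterlim t at_top sequentially \<and> (\<forall>k. x k \<in> K) \<and>
         (\<lambda>k. x k /\<^sub>R t k) \<longlonglongrightarrow> u}"

definition pointed :: "'a::real_vector set \<Rightarrow> bool" where
  "pointed S \<longleftrightarrow> S \<inter> uminus ` S \<subseteq> {0}"

text \<open>Distance to a set as an extended real: it is \<open>\<infinity>\<close> for the empty set, where
  \<^const>\<open>infdist\<close> would be \<open>0\<close>.\<close>

definition set_dist :: "'a::metric_space \<Rightarrow> 'a set \<Rightarrow> ereal" where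
  "set_dist d S = (INF s\<in>S. ereal (dist d s))"


section \<open>Weakly homogeneous mappings\<close>

text \<open>Mappings on a cone \<open>D\<close> are total functions of which only the values on \<open>D\<close> matter.\<close>

definition pos_homogeneous_on ::
    "'a::real_normed_vector set \<Rightarrow> real \<Rightarrow> ('a \<Rightarrow> 'a) \<Rightarrow> bool" where
  "pos_homogeneous_on D \<delta> h \<longleftrightarrow>
     continuous_on D h \<and> (\<forall>x\<in>D. \<forall>l>0. h (l *\<^sub>R x) = (l powr \<delta>) *\<^sub>R h x)"

text \<open>\<open>\<phi>\<close> is weakly homogeneous of degree \<open>\<delta>\<close> on \<open>D\<close> with leading term \<open>h\<close>.
  On \<open>D\<close> the leading term is determined by \<open>\<phi>\<close> and \<open>\<delta>\<close>.\<close>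

definition weakly_homogeneous_on ::
    "'a::real_normed_vector set \<Rightarrow> real \<Rightarrow> ('a \<Rightarrow> 'a) \<Rightarrow> ('a \<Rightarrow> 'a) \<Rightarrow> bool" where
  "weakly_homogeneous_on D \<delta> \<phi> h \<longleftrightarrow>
     \<delta> > 0 \<and> pos_homogeneous_on D \<delta> h \<and> continuous_on D (\<lambda>x. \<phi> x - h x) \<and>
     ((\<lambda>x. (\<phi> x - h x) /\<^sub>R (norm x powr \<delta>)) \<longlongrightarrow> 0) (inf at_infinity (principal D))"


section \<open>Variational inequalities and complementarity problems\<close>

text \<open>\<open>D\<close> is the domain of \<open>\<phi>\<close>.\<close>

definition SOL ::
    "'a::real_inner set \<Rightarrow> ('a \<Rightarrow> 'a) \<Rightarrow> ('a \<Rightarrow> 'a) \<Rightarrow> 'a set \<Rightarrow> 'a set" where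
  "SOL D \<phi> \<psi> S = {x\<in>D. \<psi> x \<in> S \<and> (\<forall>y\<in>S. 0 \<le> \<phi> x \<bullet> (y - \<psi> x))}"

definition WHGCP ::
    "'a::real_inner set \<Rightarrow> ('a \<Rightarrow> 'a) \<Rightarrow> ('a \<Rightarrow> 'a) \<Rightarrow> 'a set \<Rightarrow> 'a set" where
  "WHGCP D f g S = {x\<in>D. g x \<in> S \<and> f x \<in> dual_cone S \<and> f x \<bullet> g x = 0}"


section \<open>Brouwer degree on bounded open sets\<close>

text \<open>The library provides the degree of self-maps of the sphere. The degree of \<open>\<phi>\<close> on
  \<open>\<Omega>\<close> at \<open>b\<close> is the degree of the self-map of the one-point compactification of the space
  (a sphere via stereographic projection, with the north pole \<open>(0, 1)\<close> as \<open>\<infinity>\<close>)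
  that expands the open ball of radius \<open>\<epsilon>\<close> about \<open>b\<close> radially onto the whole space after
  \<open>\<phi>\<close>, and sends all points that are outside \<open>\<Omega>\<close> or are mapped outside that ball
  to \<open>\<infinity>\<close>. Here \<open>\<epsilon>\<close> is the distance from \<open>b\<close> to the image of the boundary of \<open>\<Omega>\<close>; any
  smaller positive number gives the same degree (\<open>brouwer_degree_eq\<close> below). The same projection is used on both sides, so
  at a regular value the preimages of \<open>b\<close> in \<open>\<Omega>\<close> count with the sign of the Jacobian
  determinant.\<close>

definition stereographic :: "'a::real_normed_vector \<Rightarrow> 'a \<times> real" where
  "stereographic x =
     ((2 / ((norm x)\<^sup>2 + 1)) *\<^sub>R x, ((norm x)\<^sup>2 - 1) / ((norm x)\<^sup>2 + 1))"

definition inv_stereographic :: "'a::real_normed_vector \<times> real \<Rightarrow> 'a" where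
  "inv_stereographic p = fst p /\<^sub>R (1 - snd p)"

definition expand_ball :: "real \<Rightarrow> 'a::real_normed_vector \<Rightarrow> 'a \<times> real" where
  "expand_ball \<epsilon> y = (if norm y < \<epsilon> then stereographic (y /\<^sub>R (\<epsilon> - norm y)) else (0, 1))"

definition collapse_map ::
    "real \<Rightarrow> ('a::real_normed_vector \<Rightarrow> 'a) \<Rightarrow> 'a set \<Rightarrow> 'a \<Rightarrow> 'a \<times> real \<Rightarrow> 'a \<times> real" where
  "collapse_map \<epsilon> \<phi> \<Omega> b p =
     (if p \<noteq> (0, 1) \<and> inv_stereographic p \<in> \<Omega>
      then expand_ball \<epsilon> (\<phi> (inv_stereographic p) - b) else (0, 1))"

text \<open>Conjugating with another homeomorphism does not change the degree, so the choice of \<open>h\<close>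
  is immaterial.\<close>

definition sphere_degree :: "('b::euclidean_space \<Rightarrow> 'b) \<Rightarrow> int" where
  "sphere_degree \<Phi> =
     (let n = DIM('b) - 1;
          (h, h') = (SOME (h, h'). homeomorphic_maps (nsphere n) (top_of_set (sphere 0 1)) h h')
      in Brouwer_degree2 n (h' \<circ> \<Phi> \<circ> h))"

text \<open>The value is \<open>0\<close> where the degree is undefined, so \<open>\<noteq> 0\<close> includes definedness.\<close>

definition brouwer_degree ::
    "('a::euclidean_space \<Rightarrow> 'a) \<Rightarrow> 'a set \<Rightarrow> 'a \<Rightarrow> int" where
  "brouwer_degree \<phi> \<Omega> b =
     (if bounded \<Omega> \<and> open \<Omega> \<and> continuous_on (closure \<Omega>) \<phi> \<and> b \<notin> \<phi> ` frontier \<Omega>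
      then sphere_degree (collapse_map (infdist b (\<phi> ` frontier \<Omega>)) \<phi> \<Omega> b)
      else 0)"


subsection \<open>Homotopy invariance, excision, solution property and normalization\<close>

lemma norm_prod_sq: "(norm (p::'a::real_inner \<times> real))\<^sup>2 = (norm (fst p))\<^sup>2 + (snd p)\<^sup>2"
  by (cases p) (simp add: norm_Pair)

lemma stereographic_in_sphere [simp]:
  "stereographic (x::'a::real_inner) \<in> sphere 0 1"
proof -
  have "(norm x)\<^sup>2 + 1 > 0" by (smt (verit) zero_le_power2)
  then have "(norm (stereographic x))\<^sup>2 = 1"
    unfolding norm_prod_sq stereographic_def
    by (simp add: power_mult_distrib power_divide divide_simps)
       (simp add: power2_eq_square algebra_simps)
  then show ?thesis
    using power2_eq_1_iff[of "norm (stereographic x)"] norm_ge_zero[of "stereographic x"] by simp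
qed

lemma stereographic_neq: "stereographic x \<noteq> (0, 1)"
proof -
  have "(norm x)\<^sup>2 + 1 > 0" by (smt (verit) zero_le_power2)
  then show ?thesis by (simp add: stereographic_def field_simps)
qed

lemma inv_stereographic_stereographic [simp]: "inv_stereographic (stereographic x) = x"
proof -
  have *: "(norm x)\<^sup>2 + 1 > 0" by (smt (verit) zero_le_power2)
  then have e: "1 - ((norm x)\<^sup>2 - 1) / ((norm x)\<^sup>2 + 1) = 2 / ((norm x)\<^sup>2 + 1)"
    by (simp add: field_simps)
  have "inverse (2 / ((norm x)\<^sup>2 + 1)) * (2 / ((norm x)\<^sup>2 + 1)) = 1"
    using * by (intro left_inverse) simp
  then show ?thesis
    unfolding inv_stereographic_def stereographic_def fst_conv snd_conv e scaleR_scaleR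
    by (simp only: scaleR_one)
qed

lemma sphere_snd_less:
  fixes p :: "'a::real_inner \<times> real"
  assumes "p \<in> sphere 0 1" "p \<noteq> (0, 1)" shows "snd p < 1"
proof -
  have eq: "(norm (fst p))\<^sup>2 + (snd p)\<^sup>2 = 1" using assms(1) norm_prod_sq[of p] by simp
  then have "(snd p)\<^sup>2 \<le> 1" by (smt (verit) zero_le_power2)
  then have "snd p \<le> 1" by (simp add: power2_le_iff_abs_le abs_square_le_1)
  moreover have "snd p \<noteq> 1" using eq assms(2) by (cases p) auto
  ultimately show ?thesis by simp
qed

lemma stereographic_inv_stereographic:
  fixes p :: "'a::real_inner \<times> real"
  assumes "p \<in> sphere 0 1" "p \<noteq> (0, 1)"
  shows "stereographic (inv_stereographic p) = p"
proof -
  define s where "s = snd p"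
  define u where "u = fst p"
  have s: "s < 1" using sphere_snd_less[OF assms] by (simp add: s_def)
  have eq: "(norm u)\<^sup>2 = (1 - s) * (1 + s)"
    using assms(1) norm_prod_sq[of p] by (simp add: s_def u_def power2_eq_square algebra_simps)
  define c where "c = inverse (1 - s)"
  have c: "c * (1 - s) = 1" "c > 0" using s by (auto simp: c_def)
  have n: "(norm (c *\<^sub>R u))\<^sup>2 = (1 + s) / (1 - s)"
    using s eq by (simp add: c_def power_mult_distrib power2_eq_square divide_simps)
  have "(1 + s) / (1 - s) + 1 = 2 / (1 - s)" "(1 + s) / (1 - s) - 1 = 2 * s / (1 - s)"
    using s by (auto simp: field_simps)
  then have "stereographic (c *\<^sub>R u) = ((2 / (2 / (1 - s))) *\<^sub>R c *\<^sub>R u, (2 * s / (1 - s)) / (2 / (1 - s)))"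
    unfolding stereographic_def n by simp
  also have "\<dots> = (u, s)"
  proof -
    have "2 / (2 / (1 - s)) * c = 1" using c by (simp add: algebra_simps)
    then show ?thesis using s by (simp only: scaleR_scaleR) simp
  qed
  finally show ?thesis
    by (simp add: inv_stereographic_def c_def s_def u_def)
qed

lemma expand_ball_eq:
  fixes y :: "'a::real_normed_vector"
  assumes "\<epsilon> > 0"
  defines "m \<equiv> max 0 (\<epsilon> - norm y)"
  shows "expand_ball \<epsilon> y = ((2 * m / ((norm y)\<^sup>2 + m\<^sup>2)) *\<^sub>R y, ((norm y)\<^sup>2 - m\<^sup>2) / ((norm y)\<^sup>2 + m\<^sup>2))"
proof (cases "norm y < \<epsilon>")
  case True
  then have m: "m = \<epsilon> - norm y" "m > 0" by (auto simp: m_def)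
  have pos: "(norm y)\<^sup>2 + m\<^sup>2 > 0" using m by (simp add: add_nonneg_pos)
  have n: "(norm (y /\<^sub>R m))\<^sup>2 = (norm y)\<^sup>2 / m\<^sup>2"
    using m by (simp add: power_mult_distrib power_divide field_simps)
  have e: "(norm y)\<^sup>2 / m\<^sup>2 + 1 = ((norm y)\<^sup>2 + m\<^sup>2) / m\<^sup>2" "(norm y)\<^sup>2 / m\<^sup>2 - 1 = ((norm y)\<^sup>2 - m\<^sup>2) / m\<^sup>2"
    using m by (auto simp: field_simps)
  have "expand_ball \<epsilon> y = stereographic (y /\<^sub>R m)" using True m by (simp add: expand_ball_def)
  then show ?thesis
    using m(2) pos unfolding stereographic_def n e
    by (simp add: power2_eq_square inverse_eq_divide)
next
  case False
  then have "m = 0" "y \<noteq> 0" using assms by auto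
  then show ?thesis using False by (simp add: expand_ball_def)
qed

lemma continuous_on_expand_ball:
  fixes y :: "'b::topological_space \<Rightarrow> 'a::real_normed_vector"
  assumes "continuous_on S e" "continuous_on S y" "\<And>z. z \<in> S \<Longrightarrow> e z > 0"
  shows "continuous_on S (\<lambda>z. expand_ball (e z) (y z))"
proof -
  have pos: "(norm (y z))\<^sup>2 + (max 0 (e z - norm (y z)))\<^sup>2 \<noteq> 0" if "z \<in> S" for z
    using assms(3)[OF that] by (auto simp: sum_power2_eq_zero_iff)
  have "continuous_on S (\<lambda>z. let m = max 0 (e z - norm (y z)) in
     ((2 * m / ((norm (y z))\<^sup>2 + m\<^sup>2)) *\<^sub>R y z, ((norm (y z))\<^sup>2 - m\<^sup>2) / ((norm (y z))\<^sup>2 + m\<^sup>2)))"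
    unfolding Let_def by (intro continuous_intros assms) (use pos in auto)
  then show ?thesis
    by (rule continuous_on_eq) (simp add: Let_def expand_ball_eq assms(3))
qed

lemma expand_ball_in_sphere: "expand_ball \<epsilon> (y::'a::real_inner) \<in> sphere 0 1"
  using stereographic_in_sphere unfolding expand_ball_def by (auto simp: norm_Pair)

lemma collapse_map_in_sphere: "collapse_map \<epsilon> \<phi> \<Omega> (b::'a::real_inner) p \<in> sphere 0 1"
  using expand_ball_in_sphere unfolding collapse_map_def by (auto simp: norm_Pair)

lemma continuous_on_collapse_map:
  fixes h :: "real \<Rightarrow> 'a::euclidean_space \<Rightarrow> 'a"
  assumes \<Omega>: "bounded \<Omega>" "open \<Omega>"
    and h: "continuous_on ({0..1} \<times> closure \<Omega>) (\<lambda>(t, x). h t x)"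
    and e: "continuous_on {0..1} e" "\<And>t. t \<in> {0..1} \<Longrightarrow> e t > 0"
    and le: "\<And>t x. t \<in> {0..1} \<Longrightarrow> x \<in> frontier \<Omega> \<Longrightarrow> e t \<le> norm (h t x - b)"
  shows "continuous_on ({0..1} \<times> sphere 0 1) (\<lambda>(t, p). collapse_map (e t) (h t) \<Omega> b p)"
proof -
  let ?N = "(0::'a, 1::real)"
  let ?S = "sphere (0::'a\<times>real) 1"
  have inv_cont: "continuous_on (?S - {?N}) inv_stereographic"
    unfolding inv_stereographic_def
    by (intro continuous_intros) (use sphere_snd_less in fastforce)
  have st_cont: "continuous_on UNIV (stereographic :: 'a \<Rightarrow> _)"
  proof -
    have "(norm x)\<^sup>2 + 1 \<noteq> 0" for x :: 'a by (smt (verit) zero_le_power2)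
    then show ?thesis unfolding stereographic_def by (intro continuous_intros) auto
  qed
  define A where "A = stereographic ` closure \<Omega>"
  have A: "compact A" unfolding A_def
    by (rule compact_continuous_image) (use st_cont \<Omega> in \<open>auto intro: continuous_on_subset\<close>)
  have A_sub: "A \<subseteq> ?S - {?N}" unfolding A_def 
    by (intro image_subsetI) (use stereographic_in_sphere stereographic_neq in blast)
  define U where "U = (?S - {?N}) \<inter> inv_stereographic -` \<Omega>"
  have "openin (top_of_set (?S - {?N})) U"
    unfolding U_def by (rule continuous_openin_preimage_gen[OF inv_cont \<Omega>(2)])
  then have U: "openin (top_of_set ?S) U"
    by (rule openin_trans) (simp add: openin_delete)
  have memA: "p \<in> A \<longleftrightarrow> p \<in> ?S - {?N} \<and> inv_stereographic p \<in> closure \<Omega>" for p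
    using A_sub stereographic_inv_stereographic[of p] by (auto simp: A_def) (metis imageI)
  have UA: "U \<subseteq> A" using closure_subset memA unfolding U_def by blast
  have cA: "closed ({0..1::real} \<times> A)" by (simp add: A compact_imp_closed closed_Times)
  have "closed (?S - U)"
    using U by (metis closedin_closed_eq closedin_diff closed_sphere closedin_topspace topspace_euclidean_subtopology)
  then have cB: "closed ({0..1::real} \<times> (?S - U))" by (simp add: closed_Times)
  have "continuous_on (({0..1} \<times> A) \<union> ({0..1} \<times> (?S - U)))
    (\<lambda>z. if z \<in> {0..1} \<times> A then expand_ball (e (fst z)) (h (fst z) (inv_stereographic (snd z)) - b) else ?N)"
  proof (rule continuous_on_cases[OF cA cB])
    have "continuous_on ({0..1} \<times> A) ((\<lambda>(t, x). h t x) \<circ> (\<lambda>z. (fst z, inv_stereographic (snd z))))"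
    proof (rule continuous_on_compose)
      show "continuous_on ({0..1} \<times> A) (\<lambda>z. (fst z, inv_stereographic (snd z)))"
        by (intro continuous_intros continuous_on_compose2[OF inv_cont]) (use A_sub in auto)
      show "continuous_on ((\<lambda>z. (fst z, inv_stereographic (snd z))) ` ({0..1} \<times> A)) (\<lambda>(t, x). h t x)"
        by (rule continuous_on_subset[OF h]) (use memA in auto)
    qed
    then show "continuous_on ({0..1} \<times> A)
       (\<lambda>z. expand_ball (e (fst z)) (h (fst z) (inv_stereographic (snd z)) - b))"
      by (intro continuous_on_expand_ball continuous_intros continuous_on_compose2[OF e(1)])
         (auto simp: o_def case_prod_unfold e(2))
    show "\<forall>z. z \<in> {0..1} \<times> A \<and> z \<notin> {0..1} \<times> A \<or> z \<in> {0..1} \<times> (?S - U) \<and> z \<in> {0..1} \<times> A \<longrightarrow>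
      expand_ball (e (fst z)) (h (fst z) (inv_stereographic (snd z)) - b) = ?N"
    proof clarify
      fix t :: real and p assume "(t,p) \<in> {0..1} \<times> A \<and> (t,p) \<notin> {0..1} \<times> A \<or> (t,p) \<in> {0..1} \<times> (?S - U) \<and> (t,p) \<in> {0..1} \<times> A"
      then have t: "t \<in> {0..1}" and p: "p \<in> A" "p \<notin> U" by auto
      then have "inv_stereographic p \<in> frontier \<Omega>"
        using memA[of p] \<Omega>(2) by (auto simp: U_def frontier_def interior_open)
      from le[OF t this] show "expand_ball (e (fst (t,p))) (h (fst (t,p)) (inv_stereographic (snd (t,p))) - b) = ?N"
        by (simp add: expand_ball_def)
    qed
  qed simp
  moreover have "({0..1} \<times> A) \<union> ({0..1} \<times> (?S - U)) = {0..1::real} \<times> ?S"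
    using UA A_sub by blast
  ultimately have *: "continuous_on ({0..1} \<times> ?S)
    (\<lambda>z. if z \<in> {0..1} \<times> A then expand_ball (e (fst z)) (h (fst z) (inv_stereographic (snd z)) - b) else ?N)"
    by simp
  show ?thesis
  proof (rule continuous_on_eq[OF *], clarify)
    fix t :: real and p assume tp: "t \<in> {0..1}" "p \<in> ?S"
    show "(if (t,p) \<in> {0..1} \<times> A then expand_ball (e (fst (t,p))) (h (fst (t,p)) (inv_stereographic (snd (t,p))) - b) else ?N)
       = collapse_map (e t) (h t) \<Omega> b p"
    proof (cases "p \<in> U")
      case True
      then show ?thesis using tp UA by (auto simp: collapse_map_def U_def)
    next
      case False
      then have c: "collapse_map (e t) (h t) \<Omega> b p = ?N"
        using tp by (auto simp: collapse_map_def U_def)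
      show ?thesis
      proof (cases "p \<in> A")
        case True
        then have "inv_stereographic p \<in> frontier \<Omega>"
          using memA[of p] False \<Omega>(2) by (auto simp: U_def frontier_def interior_open)
        from le[OF tp(1) this] show ?thesis using c by (simp add: expand_ball_def)
      qed (simp add: c)
    qed
  qed
qed

lemma sphere_degree_conjugate:
  obtains h h' where
    "homeomorphic_maps (nsphere (DIM('b) - 1)) (top_of_set (sphere (0::'b::euclidean_space) 1)) h h'"
    "\<And>\<Phi>::'b \<Rightarrow> 'b. sphere_degree \<Phi> = Brouwer_degree2 (DIM('b) - 1) (h' \<circ> \<Phi> \<circ> h)"
proof -
  let ?P = "\<lambda>(h, h'). homeomorphic_maps (nsphere (DIM('b) - 1)) (top_of_set (sphere (0::'b) 1)) h h'"
  obtain f :: "(nat \<Rightarrow> real) \<Rightarrow> 'b" and g where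
    "homeomorphic_maps (nsphere (DIM('b) - 1)) (top_of_set (sphere 0 1 \<inter> span Basis)) f g"
    using homeomorphic_maps_nsphere_euclidean_sphere[OF independent_Basis orthogonal_Basis refl _ norm_Basis]
    by auto
  then have "?P (f, g)" by simp
  then have P: "?P (Eps ?P)" by (rule someI)
  obtain h h' where hh: "Eps ?P = (h, h')" by fastforce
  show thesis
  proof (rule that)
    show "homeomorphic_maps (nsphere (DIM('b) - 1)) (top_of_set (sphere (0::'b) 1)) h h'"
      using P unfolding hh by simp
    show "sphere_degree \<Phi> = Brouwer_degree2 (DIM('b) - 1) (h' \<circ> \<Phi> \<circ> h)" for \<Phi> :: "'b \<Rightarrow> 'b"
      unfolding sphere_degree_def Let_def hh by simp
  qed
qed

lemma sphere_degree_homotopic: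
  fixes \<Phi> \<Psi> :: "'b::euclidean_space \<Rightarrow> 'b"
  assumes "homotopic_with_canon (\<lambda>_. True) (sphere 0 1) (sphere 0 1) \<Phi> \<Psi>"
  shows "sphere_degree \<Phi> = sphere_degree \<Psi>"
proof -
  obtain h h' where
    hom: "homeomorphic_maps (nsphere (DIM('b) - 1)) (top_of_set (sphere (0::'b::euclidean_space) 1)) h h'"
    and eq: "\<And>\<Phi>::'b \<Rightarrow> 'b. sphere_degree \<Phi> = Brouwer_degree2 (DIM('b) - 1) (h' \<circ> \<Phi> \<circ> h)"
    using sphere_degree_conjugate by blast
  have "homotopic_with (\<lambda>_. True) (nsphere (DIM('b) - 1)) (nsphere (DIM('b) - 1)) (h' \<circ> \<Phi> \<circ> h) (h' \<circ> \<Psi> \<circ> h)"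
    by (rule homotopic_with_compose_continuous_map_right[OF
          homotopic_with_compose_continuous_map_left[OF assms]])
       (use hom in \<open>auto simp: homeomorphic_maps_def\<close>)
  then show ?thesis unfolding eq by (rule Brouwer_degree2_homotopic)
qed

lemma sphere_degree_id: "sphere_degree (id :: 'b::euclidean_space \<Rightarrow> 'b) = 1"
proof -
  obtain h h' where
    hom: "homeomorphic_maps (nsphere (DIM('b) - 1)) (top_of_set (sphere (0::'b::euclidean_space) 1)) h h'"
    and eq: "\<And>\<Phi>::'b \<Rightarrow> 'b. sphere_degree \<Phi> = Brouwer_degree2 (DIM('b) - 1) (h' \<circ> \<Phi> \<circ> h)"
    using sphere_degree_conjugate by blast
  have "Brouwer_degree2 (DIM('b) - 1) (h' \<circ> id \<circ> h) = Brouwer_degree2 (DIM('b) - 1) id"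
    by (rule Brouwer_degree2_eq) (use hom in \<open>auto simp: homeomorphic_maps_def\<close>)
  then show ?thesis by (simp add: eq)
qed

lemma sphere_degree_const: "sphere_degree (\<lambda>_. a :: 'b::euclidean_space) = 0"
proof -
  obtain h h' where
    eq: "\<And>\<Phi>::'b \<Rightarrow> 'b. sphere_degree \<Phi> = Brouwer_degree2 (DIM('b) - 1) (h' \<circ> \<Phi> \<circ> h)"
    using sphere_degree_conjugate by blast
  have "h' \<circ> (\<lambda>_. a) \<circ> h = (\<lambda>_. h' a)" by auto
  then show ?thesis by (simp add: eq Brouwer_degree2_const)
qed

lemma collapse_map_homotopic:
  fixes h :: "real \<Rightarrow> 'a::euclidean_space \<Rightarrow> 'a"
  assumes "bounded \<Omega>" "open \<Omega>"
    and "continuous_on ({0..1} \<times> closure \<Omega>) (\<lambda>(t, x). h t x)"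
    and "continuous_on {0..1} e" "\<And>t. t \<in> {0..1} \<Longrightarrow> e t > 0"
    and "\<And>t x. t \<in> {0..1} \<Longrightarrow> x \<in> frontier \<Omega> \<Longrightarrow> e t \<le> norm (h t x - b)"
  shows "sphere_degree (collapse_map (e 0) (h 0) \<Omega> b) = sphere_degree (collapse_map (e 1) (h 1) \<Omega> b)"
proof (rule sphere_degree_homotopic)
  show "homotopic_with_canon (\<lambda>_. True) (sphere 0 1) (sphere 0 1)
     (collapse_map (e 0) (h 0) \<Omega> b) (collapse_map (e 1) (h 1) \<Omega> b)"
    unfolding homotopic_with_def
    using continuous_on_collapse_map[OF assms] collapse_map_in_sphere
    by (intro exI[of _ "\<lambda>(t, p). collapse_map (e t) (h t) \<Omega> b p"])
       (auto simp: continuous_map_in_subtopology prod_topology_subtopology_eu simp del: mem_sphere_0)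
qed

lemma brouwer_degree_eq:
  fixes \<phi> :: "'a::euclidean_space \<Rightarrow> 'a"
  assumes \<Omega>: "bounded \<Omega>" "open \<Omega>" "continuous_on (closure \<Omega>) \<phi>"
    and \<epsilon>: "\<epsilon> > 0" "\<And>x. x \<in> frontier \<Omega> \<Longrightarrow> \<epsilon> \<le> norm (\<phi> x - b)"
  shows "brouwer_degree \<phi> \<Omega> b = sphere_degree (collapse_map \<epsilon> \<phi> \<Omega> b)"
proof (cases "\<Omega> = {}")
  case True
  then have "collapse_map \<delta> \<phi> \<Omega> b = (\<lambda>_. (0, 1))" for \<delta> by (auto simp: collapse_map_def)
  then show ?thesis using True by (simp add: brouwer_degree_def)
next
  case False
  have b: "b \<notin> \<phi> ` frontier \<Omega>" using \<epsilon> by fastforce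
  define \<rho> where "\<rho> = infdist b (\<phi> ` frontier \<Omega>)"
  have ne: "frontier \<Omega> \<noteq> {}"
    using False \<Omega>(1) frontier_eq_empty not_bounded_UNIV by blast
  have "\<epsilon> \<le> \<rho>"
    using ne \<epsilon>(2) unfolding \<rho>_def infdist_def
    by (auto intro!: cINF_greatest simp: dist_norm norm_minus_commute)
  have \<rho>_le: "\<rho> \<le> norm (\<phi> x - b)" if "x \<in> frontier \<Omega>" for x
    using infdist_le[of "\<phi> x" "\<phi> ` frontier \<Omega>" b] that by (simp add: \<rho>_def dist_norm norm_minus_commute)
  define e where "e t = (1 - t) * \<rho> + t * \<epsilon>" for t
  have "sphere_degree (collapse_map (e 0) \<phi> \<Omega> b) = sphere_degree (collapse_map (e 1) \<phi> \<Omega> b)"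
  proof (rule collapse_map_homotopic[where h = "\<lambda>_. \<phi>", OF \<Omega>(1,2)])
    show "continuous_on ({0..1} \<times> closure \<Omega>) (\<lambda>(t::real, x). \<phi> x)"
      unfolding case_prod_unfold by (rule continuous_on_compose2[OF \<Omega>(3)]) (auto intro: continuous_intros)
    show "continuous_on {0..1} e" unfolding e_def by (intro continuous_intros)
    fix t :: real assume t: "t \<in> {0..1}"
    have e: "\<epsilon> \<le> e t" "e t \<le> \<rho>" unfolding e_def
      using t \<open>\<epsilon> \<le> \<rho>\<close> convex_bound_le[of \<rho> \<rho> \<epsilon> "1-t" t] convex_bound_le[of "-\<rho>" "-\<epsilon>" "-\<epsilon>" "1-t" t] by auto
    then show "e t > 0" using \<epsilon>(1) by simp
    show "e t \<le> norm (\<phi> x - b)" if "x \<in> frontier \<Omega>" for x using e \<rho>_le[OF that] by simp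
  qed
  then show ?thesis using \<Omega> b by (simp add: brouwer_degree_def e_def \<rho>_def)
qed

lemma frontier_norm_bound:
  fixes \<phi> :: "'b::metric_space \<Rightarrow> 'a::real_normed_vector"
  assumes "compact S" "continuous_on S \<phi>" "b \<notin> \<phi> ` S"
  obtains \<epsilon> where "\<epsilon> > 0" "\<And>x. x \<in> S \<Longrightarrow> \<epsilon> \<le> norm (\<phi> x - b)"
proof (cases "S = {}")
  case False
  have "continuous_on S (\<lambda>x. norm (\<phi> x - b))" by (intro continuous_intros assms)
  from continuous_attains_inf[OF assms(1) False this] obtain x
    where "x \<in> S" "\<And>y. y \<in> S \<Longrightarrow> norm (\<phi> x - b) \<le> norm (\<phi> y - b)" by blast
  then show ?thesis using assms(3) by (intro that[of "norm (\<phi> x - b)"]) auto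
qed (use that[of 1] in auto)

theorem brouwer_degree_homotopy:
  fixes h :: "real \<Rightarrow> 'a::euclidean_space \<Rightarrow> 'a"
  assumes \<Omega>: "bounded \<Omega>" "open \<Omega>"
    and h: "continuous_on ({0..1} \<times> closure \<Omega>) (\<lambda>(t, x). h t x)"
    and b: "\<And>t x. t \<in> {0..1} \<Longrightarrow> x \<in> frontier \<Omega> \<Longrightarrow> h t x \<noteq> b"
  shows "brouwer_degree (h 0) \<Omega> b = brouwer_degree (h 1) \<Omega> b"
proof -
  have "compact ({0..1::real} \<times> frontier \<Omega>)"
    using \<Omega>(1) by (intro compact_Times) (auto intro: compact_frontier_bounded)
  moreover have "continuous_on ({0..1} \<times> frontier \<Omega>) (\<lambda>(t, x). h t x)"
    by (rule continuous_on_subset[OF h]) (auto simp: frontier_def)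
  moreover have "b \<notin> (\<lambda>(t, x). h t x) ` ({0..1} \<times> frontier \<Omega>)" using b by fastforce
  ultimately obtain \<epsilon> where \<epsilon>: "\<epsilon> > 0"
    "\<And>z. z \<in> {0..1} \<times> frontier \<Omega> \<Longrightarrow> \<epsilon> \<le> norm ((\<lambda>(t, x). h t x) z - b)"
    using frontier_norm_bound by blast
  have ht: "continuous_on (closure \<Omega>) (h t)" if "t \<in> {0..1}" for t
  proof -
    have "continuous_on (closure \<Omega>) (\<lambda>x. (\<lambda>(t, x). h t x) (t, x))"
      by (rule continuous_on_compose2[OF h]) (use that in \<open>auto intro!: continuous_on_Pair\<close>)
    then show ?thesis by simp
  qed
  have "brouwer_degree (h t) \<Omega> b = sphere_degree (collapse_map \<epsilon> (h t) \<Omega> b)" if "t \<in> {0..1}" for t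
    using \<epsilon>(2)[of "(t, _)"] that by (intro brouwer_degree_eq \<Omega> ht \<epsilon>(1)) auto
  moreover have "sphere_degree (collapse_map \<epsilon> (h 0) \<Omega> b) = sphere_degree (collapse_map \<epsilon> (h 1) \<Omega> b)"
    using collapse_map_homotopic[OF \<Omega> h, of "\<lambda>_. \<epsilon>" b] \<epsilon> by force
  ultimately show ?thesis by simp
qed

theorem brouwer_degree_excision:
  fixes \<phi> :: "'a::euclidean_space \<Rightarrow> 'a"
  assumes \<Omega>: "bounded \<Omega>" "open \<Omega>" "continuous_on (closure \<Omega>) \<phi>"
    and U: "open U" "U \<subseteq> \<Omega>" "b \<notin> \<phi> ` (closure \<Omega> - U)"
  shows "brouwer_degree \<phi> \<Omega> b = brouwer_degree \<phi> U b"
proof -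
  have "compact (closure \<Omega> - U)" using \<Omega>(1) U(1) by (simp add: compact_closure compact_diff)
  moreover have "continuous_on (closure \<Omega> - U) \<phi>" by (rule continuous_on_subset[OF \<Omega>(3)]) auto
  ultimately obtain \<epsilon> where \<epsilon>: "\<epsilon> > 0" "\<And>x. x \<in> closure \<Omega> - U \<Longrightarrow> \<epsilon> \<le> norm (\<phi> x - b)"
    using U(3) frontier_norm_bound by blast
  have cl: "closure U \<subseteq> closure \<Omega>" by (rule closure_mono[OF U(2)])
  have "brouwer_degree \<phi> \<Omega> b = sphere_degree (collapse_map \<epsilon> \<phi> \<Omega> b)"
    by (rule brouwer_degree_eq[OF \<Omega> \<epsilon>(1)])
       (use \<epsilon>(2) U(2) \<Omega>(2) in \<open>auto simp: frontier_def interior_open\<close>)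
  also have "collapse_map \<epsilon> \<phi> \<Omega> b = collapse_map \<epsilon> \<phi> U b"
  proof
    fix p :: "'a \<times> real"
    show "collapse_map \<epsilon> \<phi> \<Omega> b p = collapse_map \<epsilon> \<phi> U b p"
      using \<epsilon>(2)[of "inv_stereographic p"] closure_subset[of \<Omega>] U(2)
      by (auto simp: collapse_map_def expand_ball_def)
  qed
  also have "sphere_degree (collapse_map \<epsilon> \<phi> U b) = brouwer_degree \<phi> U b"
    by (rule brouwer_degree_eq[symmetric, OF bounded_subset[OF \<Omega>(1) U(2)] U(1)
          continuous_on_subset[OF \<Omega>(3) cl] \<epsilon>(1)])
       (use \<epsilon>(2) U(1) cl in \<open>auto simp: frontier_def interior_open\<close>)
  finally show ?thesis .
qed

theorem brouwer_degree_solution: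
  assumes "brouwer_degree \<phi> \<Omega> b \<noteq> 0"
  shows "\<exists>x\<in>\<Omega>. \<phi> x = b"
proof (rule ccontr)
  assume no: "\<not> (\<exists>x\<in>\<Omega>. \<phi> x = b)"
  have "bounded \<Omega>" "open \<Omega>" "continuous_on (closure \<Omega>) \<phi>" "b \<notin> \<phi> ` frontier \<Omega>"
    using assms by (auto simp: brouwer_degree_def split: if_splits)
  moreover from this have "b \<notin> \<phi> ` (closure \<Omega> - {})"
    using no by (auto simp: frontier_def interior_open)
  ultimately have "brouwer_degree \<phi> \<Omega> b = brouwer_degree \<phi> {} b"
    by (intro brouwer_degree_excision) auto
  also have "\<dots> = 0"
  proof -
    have "collapse_map \<delta> \<phi> {} b = (\<lambda>_. (0, 1))" for \<delta> by (auto simp: collapse_map_def)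
    then show ?thesis by (simp add: brouwer_degree_def sphere_degree_const)
  qed
  finally show False using assms by simp
qed

lemma homotopic_sphere_nonantipodal:
  fixes \<Phi> :: "'b::euclidean_space \<Rightarrow> 'b"
  assumes \<Phi>: "continuous_on (sphere 0 1) \<Phi>" "\<Phi> \<in> sphere 0 1 \<rightarrow> sphere 0 1"
    and ne: "\<And>p. p \<in> sphere 0 1 \<Longrightarrow> \<Phi> p \<noteq> - p"
  shows "homotopic_with_canon (\<lambda>_. True) (sphere 0 1) (sphere 0 1) \<Phi> id"
proof -
  define H where "H z = (1 - fst z) *\<^sub>R \<Phi> (snd z) + fst z *\<^sub>R snd z" for z
  have H0: "H z \<noteq> 0" if "z \<in> {0..1} \<times> sphere 0 1" for z
  proof
    assume 0: "H z = 0"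
    obtain t p where z: "z = (t, p)" "t \<in> {0..1}" "p \<in> sphere 0 1" using \<open>z \<in> _\<close> by auto
    have eq: "(1 - t) *\<^sub>R \<Phi> p = - (t *\<^sub>R p)" using 0 z by (simp add: H_def eq_neg_iff_add_eq_0)
    moreover have n: "norm (\<Phi> p) = 1" "norm p = 1" using z \<Phi>(2) by (auto simp: Pi_iff)
    ultimately have "norm ((1 - t) *\<^sub>R \<Phi> p) = norm (t *\<^sub>R p)" by simp
    then have "1 - t = t" using z n by simp
    then have "t = 1/2" by simp
    with eq have "(1/2) *\<^sub>R \<Phi> p = (1/2) *\<^sub>R (- p)" by simp
    then have "\<Phi> p = - p" by (metis scaleR_left_imp_eq zero_neq_one divide_eq_0_iff zero_neq_numeral)
    then show False using ne z by blast
  qed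
  have "continuous_on ({0..1} \<times> sphere 0 1) H"
    unfolding H_def by (intro continuous_intros continuous_on_compose2[OF \<Phi>(1)]) auto
  then have "continuous_on ({0..1} \<times> sphere 0 1) (\<lambda>z. H z /\<^sub>R norm (H z))"
    by (intro continuous_intros) (use H0 in auto)
  then show ?thesis
    using H0 \<Phi>(2)
    by (subst homotopic_with, blast, intro exI[of _ "\<lambda>z. H z /\<^sub>R norm (H z)"])
       (auto simp: continuous_map_in_subtopology prod_topology_subtopology_eu H_def Pi_iff)
qed

theorem brouwer_degree_id:
  fixes \<Omega> :: "'a::euclidean_space set"
  assumes \<Omega>: "bounded \<Omega>" "open \<Omega>" "b \<in> \<Omega>"
  shows "brouwer_degree (\<lambda>x. x) \<Omega> b = 1"
proof -
  obtain R where R: "R > 0" "\<Omega> \<subseteq> ball 0 R" using bounded_subset_ballD[OF \<Omega>(1)] by blast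
  let ?B = "ball (0::'a) R"
  have fr: "frontier ?B = sphere 0 R" and cl: "closure ?B = cball 0 R" using R(1) by auto
  have bR: "norm b < R" using R \<Omega> by auto
  have sph: "collapse_map \<epsilon> \<phi> ?B b p \<in> sphere 0 1" for \<epsilon> \<phi> p b by (rule collapse_map_in_sphere)
  have "brouwer_degree (\<lambda>x. x) \<Omega> b = brouwer_degree (\<lambda>x. x) ?B b"
    by (rule brouwer_degree_excision[symmetric]) (use R \<Omega> in auto)
  also have "\<dots> = sphere_degree (collapse_map (R - norm b) (\<lambda>x. x) ?B b)"
    using bR R(1) norm_triangle_ineq2[of _ b] by (intro brouwer_degree_eq) auto
  also have "collapse_map (R - norm b) (\<lambda>x. x) ?B b = collapse_map (R - norm b) (\<lambda>x. x - b) ?B 0"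
    by (auto simp: collapse_map_def fun_eq_iff)
  also have "sphere_degree \<dots> = brouwer_degree (\<lambda>x. x - 1 *\<^sub>R b) ?B 0"
    using bR R(1) norm_triangle_ineq2[of _ b]
    by (simp, intro brouwer_degree_eq[symmetric]) (auto intro!: continuous_intros)
  also have "\<dots> = brouwer_degree (\<lambda>x. x - 0 *\<^sub>R b) ?B 0"
  proof (rule brouwer_degree_homotopy[symmetric, where h = "\<lambda>t x. x - t *\<^sub>R b"])
    show "x - t *\<^sub>R b \<noteq> 0" if "t \<in> {0..1}" "x \<in> frontier ?B" for t x
    proof
      assume "x - t *\<^sub>R b = 0"
      then have "norm x = t * norm b" using that by simp
      also have "\<dots> \<le> norm b" using that mult_left_le_one_le[of "norm b" t] by simp
      finally show False using that bR fr by auto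
    qed
  qed (auto simp: case_prod_unfold intro!: continuous_intros)
  also have "\<dots> = brouwer_degree (\<lambda>x. x) ?B 0" by simp
  also have "\<dots> = sphere_degree (collapse_map R (\<lambda>x. x) ?B 0)"
    by (rule brouwer_degree_eq) (use R in auto)
  also have "\<dots> = sphere_degree (id :: 'a \<times> real \<Rightarrow> _)"
  proof (intro sphere_degree_homotopic homotopic_sphere_nonantipodal)
    let ?\<Phi> = "collapse_map R (\<lambda>x. x) ?B (0::'a)"
    have *: "continuous_on ({0..1::real} \<times> sphere 0 1) (\<lambda>(t, p). collapse_map ((\<lambda>_. R) t) ((\<lambda>_ x. x) t) ?B 0 p)"
      by (rule continuous_on_collapse_map) (use R in \<open>auto simp: case_prod_unfold intro!: continuous_intros\<close>)
    show "continuous_on (sphere 0 1) ?\<Phi>"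
    proof -
      have "continuous_on (sphere 0 1) (\<lambda>p. (\<lambda>(t, p). collapse_map R (\<lambda>x. x) ?B (0::'a) p) (0::real, p))"
        by (rule continuous_on_compose2[OF *]) (auto intro!: continuous_on_Pair)
      then show ?thesis by simp
    qed
    show "?\<Phi> \<in> sphere 0 1 \<rightarrow> sphere 0 1" using sph by blast
    fix p :: "'a \<times> real" assume p: "p \<in> sphere 0 1"
    show "?\<Phi> p \<noteq> - p"
    proof (cases "p = (0, 1) \<or> inv_stereographic p \<notin> ?B")
      case True
      have "p \<noteq> (0, -1)" if "inv_stereographic p \<notin> ?B"
        using that R(1) by (auto simp: inv_stereographic_def)
      with True show ?thesis by (cases p) (auto simp: collapse_map_def)
    next
      case False
      define x where "x = inv_stereographic p"
      define k where "k = inverse (R - norm x)"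
      have x: "norm x < R" using False by (simp add: x_def)
      then have k: "k > 0" by (simp add: k_def)
      have px: "p = stereographic x" using False p by (simp add: x_def stereographic_inv_stereographic)
      have \<Phi>p: "?\<Phi> p = stereographic (k *\<^sub>R x)"
        using False x by (simp add: collapse_map_def expand_ball_def k_def flip: x_def)
      show ?thesis
      proof
        assume eq: "?\<Phi> p = - p"
        have pos: "(norm y)\<^sup>2 + 1 > 0" for y :: 'a by (smt (verit) zero_le_power2)
        define a where "a = 2 / ((norm (k *\<^sub>R x))\<^sup>2 + 1) * k + 2 / ((norm x)\<^sup>2 + 1)"
        have "a > 0" unfolding a_def
          by (intro add_pos_pos mult_pos_pos divide_pos_pos pos k zero_less_numeral)
        have "fst (stereographic (k *\<^sub>R x)) + fst (stereographic x) = 0"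
          using eq \<Phi>p px by (metis add.left_inverse fst_uminus)
        then have "a *\<^sub>R x = 0" by (simp add: stereographic_def a_def scaleR_left_distrib)
        then have "x = 0" using \<open>a > 0\<close> by simp
        then show False using eq \<Phi>p px by (simp add: stereographic_def)
      qed
    qed
  qed
  also have "\<dots> = 1" by (rule sphere_degree_id)
  finally show ?thesis .
qed

end

(* With R the recession cone of K, solutions are the zeros of the natural map
   g - P_S (g - f), where P_S is the projection onto S = K or S = R. Let (f0, g0)
   be (F, g) in case (a) and (F^\<infinity>, g^\<infinity>) in case (b). The homotopy from the problem
   (f0 + d, g0, R) to (f, g, K) runs through the sets t K + R; its zeros stay bounded,
   because normalising an unbounded sequence of zeros produces a nonzero solution for the leading
   terms on R. On \<Omega> the distance condition puts g0 - f0 - d into the polar cone of R, so the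
   initial natural map equals g0 there, and as 0 is its only zero, excision transports the nonzero
   degree of g0 on \<Omega> to a large ball. The complementarity problem is the case K = R. *)

theory Submission
  imports Defs
begin

section \<open>Recession cones of closed convex sets\<close>

text \<open>If \<open>x k / t k\<close> tends to \<open>u\<close>, then points on the segments from
  \<open>k0\<close> to \<open>x k\<close> tend to \<open>k0 + s u\<close>; conversely, the ray
  itself supplies the sequence. Since \<open>k0\<close> is arbitrary, a direction admissible at one
  point of \<open>K\<close> is admissible at every point, which is how the next lemmas use
  it.\<close>

lemma recession_cone_iff:
  fixes K :: "'a::euclidean_space set"
  assumes "closed K" "convex K" "k0 \<in> K"
  shows "u \<in> recession_cone K \<longleftrightarrow> (\<forall>s\<ge>0. k0 + s *\<^sub>R u \<in> K)"
proof
  assume "u \<in> recession_cone K"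
  then obtain t :: "nat \<Rightarrow> real" and x where t: "filterlim t at_top sequentially"
    and x: "\<And>k. x k \<in> K" and lim: "(\<lambda>k. x k /\<^sub>R t k) \<longlonglongrightarrow> u"
    unfolding recession_cone_def by blast
  show "\<forall>s\<ge>0. k0 + s *\<^sub>R u \<in> K"
  proof (intro allI impI)
    fix s :: real assume s: "0 \<le> s"
    have inv: "(\<lambda>k. inverse (t k)) \<longlonglongrightarrow> 0"
      using t by (rule tendsto_inverse_0_at_top)
    have "(\<lambda>k. (1 - s * inverse (t k)) *\<^sub>R k0 + s *\<^sub>R (x k /\<^sub>R t k)) \<longlonglongrightarrow> (1 - s * 0) *\<^sub>R k0 + s *\<^sub>R u"
      by (intro tendsto_intros inv lim)
    \<comment> \<open>The bound \<open>max s 1\<close> makes \<open>t k\<close> positive and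
      \<open>s / t k\<close> at most 1, so the point is a convex combination of \<open>k0\<close>
      and \<open>x k\<close>.\<close>
    moreover have "\<forall>\<^sub>F k in sequentially. (1 - s * inverse (t k)) *\<^sub>R k0 + s *\<^sub>R (x k /\<^sub>R t k) \<in> K"
      using t[unfolded filterlim_at_top, rule_format, of "max s 1"]
    proof eventually_elim
      case (elim k)
      then have "s * inverse (t k) \<le> 1" "0 \<le> s * inverse (t k)"
        using s by (auto simp: field_simps)
      then show ?case
        using convexD_alt[OF assms(2) assms(3) x[of k], of "s * inverse (t k)"] by simp
    qed
    ultimately show "k0 + s *\<^sub>R u \<in> K"
      using Lim_in_closed_set[OF assms(1)] by fastforce
  qed
next
  assume *: "\<forall>s\<ge>0. k0 + s *\<^sub>R u \<in> K"
  \<comment> \<open>Starting at \<open>Suc k\<close> avoids the divisor 0, so the quotient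
    simplifies for every index.\<close>
  have t: "filterlim (\<lambda>k. real (Suc k)) at_top sequentially"
    using filterlim_real_sequentially by (simp only: filterlim_sequentially_Suc)
  have "(\<lambda>k. inverse (real (Suc k)) *\<^sub>R k0 + u) \<longlonglongrightarrow> 0 *\<^sub>R k0 + u"
    by (intro tendsto_intros LIMSEQ_inverse_real_of_nat)
  then have "(\<lambda>k. (k0 + real (Suc k) *\<^sub>R u) /\<^sub>R real (Suc k)) \<longlonglongrightarrow> u"
    by (simp add: scaleR_right_distrib del: of_nat_Suc)
  then show "u \<in> recession_cone K"
    unfolding recession_cone_def using t * by (auto intro!: exI[of _ "\<lambda>k. real (Suc k)"] exI[of _ "\<lambda>k. k0 + real (Suc k) *\<^sub>R u"] simp del: of_nat_Suc)
qed

context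
  fixes K :: "'a::euclidean_space set"
  assumes K: "closed K" "convex K" "K \<noteq> {}"
begin

lemma zero_in_recession_cone: "0 \<in> recession_cone K"
  using K recession_cone_iff[of K] by fastforce

lemma recession_cone_add: "k \<in> K \<Longrightarrow> r \<in> recession_cone K \<Longrightarrow> k + r \<in> K"
  using recession_cone_iff[OF K(1,2), of k r] by (metis scaleR_one zero_le_one)

lemma recession_cone_scaleR: "u \<in> recession_cone K \<Longrightarrow> 0 \<le> c \<Longrightarrow> c *\<^sub>R u \<in> recession_cone K"
  using K(3) recession_cone_iff[OF K(1,2)] by (metis all_not_in_conv mult_nonneg_nonneg scaleR_scaleR)

lemma closed_recession_cone: "closed (recession_cone K)"
proof -
  obtain k0 where k0: "k0 \<in> K" using K by blast
  have "recession_cone K = (\<Inter>s\<in>{0..}. (\<lambda>u. k0 + s *\<^sub>R u) -` K)"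
    using recession_cone_iff[OF K(1,2) k0] by auto
  moreover have "closed ((\<lambda>u. k0 + s *\<^sub>R u) -` K)" for s
    by (intro continuous_closed_vimage K) (auto intro!: continuous_intros)
  ultimately show ?thesis by auto
qed

lemma convex_recession_cone: "convex (recession_cone K)"
proof (rule convexI)
  fix x y :: 'a and u v :: real
  assume h: "x \<in> recession_cone K" "y \<in> recession_cone K" "0 \<le> u" "0 \<le> v" "u + v = 1"
  obtain k0 where k0: "k0 \<in> K" using K by blast
  have "k0 + s *\<^sub>R (u *\<^sub>R x + v *\<^sub>R y) \<in> K" if "s \<ge> 0" for s
  proof -
    have "u *\<^sub>R (k0 + s *\<^sub>R x) + v *\<^sub>R (k0 + s *\<^sub>R y) \<in> K"
      using that h recession_cone_iff[OF K(1,2) k0] by (intro convexD[OF K(2)]) auto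
    also have "u *\<^sub>R (k0 + s *\<^sub>R x) + v *\<^sub>R (k0 + s *\<^sub>R y) = (u + v) *\<^sub>R k0 + s *\<^sub>R (u *\<^sub>R x + v *\<^sub>R y)"
      by (simp add: algebra_simps)
    finally show ?thesis using h by simp
  qed
  then show "u *\<^sub>R x + v *\<^sub>R y \<in> recession_cone K" using recession_cone_iff[OF K(1,2) k0] by blast
qed

lemma cone_recession_cone: "Convex.cone (recession_cone K)"
  using recession_cone_scaleR by (auto simp: Convex.cone_def)

lemma recession_cone_sum: 
  "x \<in> recession_cone K \<Longrightarrow> y \<in> recession_cone K \<Longrightarrow> x + y \<in> recession_cone K"
  using convex_recession_cone cone_recession_cone convex_cone[of "recession_cone K"] by simp

lemma recession_cone_subset:
  assumes "closed C" "Convex.cone C" "K \<subseteq> C"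
  shows "recession_cone K \<subseteq> C"
proof
  fix u assume "u \<in> recession_cone K"
  then obtain t :: "nat \<Rightarrow> real" and x where t: "filterlim t at_top sequentially"
    and x: "\<And>k. x k \<in> K" and lim: "(\<lambda>k. x k /\<^sub>R t k) \<longlonglongrightarrow> u"
    unfolding recession_cone_def by blast
  have "\<forall>\<^sub>F k in sequentially. x k /\<^sub>R t k \<in> C"
    using t[unfolded filterlim_at_top, rule_format, of 0]
    by eventually_elim (use x assms in \<open>auto intro!: mem_cone\<close>)
  then show "u \<in> C" using Lim_in_closed_set[OF assms(1) _ _ lim] by simp
qed

end

text \<open>A convex cone is closed under addition, so each of its elements is a direction of
  recession. This allows \<open>K\<close> to be replaced by its recession cone without changing the
  asymptotic hypotheses.\<close>

lemma recession_cone_of_cone: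
  fixes P :: "'a::euclidean_space set"
  assumes "closed P" "convex P" "Convex.cone P" "P \<noteq> {}"
  shows "recession_cone P = P"
proof
  show "recession_cone P \<subseteq> P" using assms by (intro recession_cone_subset) auto
  obtain k where k: "k \<in> P" using assms by blast
  then show "P \<subseteq> recession_cone P"
    using assms(2,3) convex_cone[of P] recession_cone_iff[OF assms(1,2) k] k by (simp add: subset_iff)
qed

section \<open>Projections onto convex sets depending on a parameter\<close>

text \<open>Expanding the squared distance from \<open>z\<close> to \<open>y\<close> around
  \<open>w\<close> shows that the obtuse angle condition makes \<open>w\<close> nearest; nearest
  points are unique.\<close>

lemma closest_point_eqI:
  fixes S :: "'a::euclidean_space set"
  assumes "convex S" "closed S" "w \<in> S" "\<And>y. y \<in> S \<Longrightarrow> (z - w) \<bullet> (y - w) \<le> 0"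
  shows "closest_point S z = w"
proof -
  have "dist z w \<le> dist z y" if "y \<in> S" for y
  proof -
    have "(z - y) \<bullet> (z - y) = (z - w) \<bullet> (z - w) - 2 * ((z - w) \<bullet> (y - w)) + (y - w) \<bullet> (y - w)"
      by (simp add: inner_simps algebra_simps inner_commute)
    then have "(z - w) \<bullet> (z - w) \<le> (z - y) \<bullet> (z - y)"
      using assms(4)[OF that] inner_ge_zero[of "y - w"] by linarith
    then show ?thesis by (simp add: dist_norm norm_le)
  qed
  then show ?thesis using closest_point_unique[OF assms(1-3)] by metis
qed

text \<open>The values stay in a fixed compact ball, so a closed graph suffices. \<open>clos\<close>
  keeps limits of projections in the limit set, \<open>lsc\<close> provides a continuous selection
  through every competitor, and \<open>bnd\<close> yields the ball.\<close>

lemma continuous_on_closest_point_family: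
  fixes S :: "real \<Rightarrow> 'a::euclidean_space set"
  assumes T: "closed T"
    and conv: "\<And>t. t \<in> T \<Longrightarrow> convex (S t)"
    and clos: "\<And>t y s w. t \<in> T \<Longrightarrow> \<forall>n. s n \<in> T \<Longrightarrow> s \<longlonglongrightarrow> t \<Longrightarrow> \<forall>n::nat. w n \<in> S (s n) \<Longrightarrow> w \<longlonglongrightarrow> y \<Longrightarrow> y \<in> S t"
    and lsc: "\<And>t y. t \<in> T \<Longrightarrow> y \<in> S t \<Longrightarrow> \<exists>h. continuous_on T h \<and> h t = y \<and> (\<forall>s\<in>T. h s \<in> S s)"
    and bnd: "\<And>t. t \<in> T \<Longrightarrow> \<exists>y\<in>S t. norm y \<le> B"
  shows "continuous_on (T \<times> cball 0 M) (\<lambda>(t, z). closest_point (S t) z)"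
proof -
  have clS: "closed (S t)" if "t \<in> T" for t
    unfolding closed_sequential_limits
    using clos[OF that, of "\<lambda>_. t"] that by auto
  have neS: "S t \<noteq> {}" if "t \<in> T" for t using bnd[OF that] by auto
  have mem: "closest_point (S t) z \<in> S t" if "t \<in> T" for t z
    using clS neS that closest_point_in_set by blast
  show ?thesis
  proof (rule continuous_from_closed_graph)
    \<comment> \<open>The projection of \<open>z\<close> is at most \<open>norm z + B\<close> away
      from \<open>z\<close>, hence the radius \<open>2 * M + B\<close>.\<close>
    show "compact (cball (0::'a) (2 * M + B))" by simp
    show "(\<lambda>(t, z). closest_point (S t) z) \<in> T \<times> cball 0 M \<rightarrow> cball 0 (2 * M + B)"
    proof clarsimp
      fix t and z :: 'a assume t: "t \<in> T" and z: "norm z \<le> M"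
      obtain y where y: "y \<in> S t" "norm y \<le> B" using bnd[OF t] by blast
      have "norm (closest_point (S t) z) \<le> norm z + dist z (closest_point (S t) z)"
        by (smt (verit) dist_norm norm_triangle_ineq2 norm_minus_commute)
      also have "\<dots> \<le> norm z + dist z y" using closest_point_le[OF clS[OF t] y(1)] by simp
      also have "\<dots> \<le> norm z + (norm z + norm y)" by (simp add: dist_norm norm_triangle_ineq4)
      finally show "norm (closest_point (S t) z) \<le> 2 * M + B" using z y by linarith
    qed
    show "closed ((\<lambda>x. (x, case x of (t, z) \<Rightarrow> closest_point (S t) z)) ` (T \<times> cball 0 M))"
      unfolding closed_sequential_limits
    proof (intro allI impI, elim conjE)
      fix a :: "nat \<Rightarrow> (real \<times> 'a) \<times> 'a" and l
      assume a: "\<forall>n. a n \<in> (\<lambda>x. (x, case x of (t, z) \<Rightarrow> closest_point (S t) z)) ` (T \<times> cball 0 M)"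
        and l: "a \<longlonglongrightarrow> l"
      obtain t z w where leq: "l = ((t, z), w)" by (metis surj_pair)
      define s where "s n = fst (fst (a n))" for n
      define v where "v n = snd (fst (a n))" for n
      define u where "u n = snd (a n)" for n
      have sT: "s n \<in> T" and vM: "v n \<in> cball 0 M" and u: "u n = closest_point (S (s n)) (v n)" for n
        using a[rule_format, of n] by (auto simp: s_def v_def u_def)
      have s: "s \<longlonglongrightarrow> t" and v: "v \<longlonglongrightarrow> z" and uw: "u \<longlonglongrightarrow> w"
        using tendsto_fst[OF tendsto_fst[OF l]] tendsto_snd[OF tendsto_fst[OF l]] tendsto_snd[OF l]
        by (simp_all add: s_def[abs_def] v_def[abs_def] u_def[abs_def] leq)
      have t: "t \<in> T" using T sT s closed_sequentially by blast
      have z: "z \<in> cball 0 M" using closed_sequentially[OF closed_cball _ v] vM by blast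
      have w: "w \<in> S t" using clos[OF t _ s _ uw] sT u mem by auto
      \<comment> \<open>A competitor \<open>y\<close> in the limit set is approached by
        \<open>h (s n)\<close> in the sets \<open>S (s n)\<close>, where the obtuse angle inequality
        holds for \<open>u n\<close>; it survives the limit.\<close>
      have "(z - w) \<bullet> (y - w) \<le> 0" if y: "y \<in> S t" for y
      proof -
        obtain h where h: "continuous_on T h" "h t = y" "\<And>s. s \<in> T \<Longrightarrow> h s \<in> S s"
          using lsc[OF t y] by blast
        have "(\<lambda>n. h (s n)) \<longlonglongrightarrow> y"
          using continuous_on_tendsto_compose[OF h(1) s t] sT h(2) by simp
        then have "(\<lambda>n. (v n - u n) \<bullet> (h (s n) - u n)) \<longlonglongrightarrow> (z - w) \<bullet> (y - w)"
          by (intro tendsto_intros v uw)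
        moreover have "(v n - u n) \<bullet> (h (s n) - u n) \<le> 0" for n
          unfolding u using sT conv clS h(3) by (intro closest_point_dot) auto
        ultimately show ?thesis by (meson LIMSEQ_le_const2)
      qed
      then have "closest_point (S t) z = w" using conv t clS w by (intro closest_point_eqI) auto
      then show "l \<in> (\<lambda>x. (x, case x of (t, z) \<Rightarrow> closest_point (S t) z)) ` (T \<times> cball 0 M)"
        using t z by (auto simp: leq image_iff)
    qed
  qed
qed

section \<open>The sets \<open>t K + R\<close>\<close>

text \<open>For nonempty closed convex \<open>K\<close> and \<open>t > 0\<close> this is just
  \<open>t K\<close>; the explicit recession summand makes \<open>t = 0\<close> give the recession
  cone instead of \<open>{0}\<close>, so that the family is continuous there.\<close>

definition shrink :: "'a::real_normed_vector set \<Rightarrow> real \<Rightarrow> 'a set" where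
  "shrink K t = {t *\<^sub>R k + r | k r. k \<in> K \<and> r \<in> recession_cone K}"

context
  fixes K :: "'a::euclidean_space set"
  assumes K: "closed K" "convex K" "K \<noteq> {}"
begin

lemma shrink_0: "shrink K 0 = recession_cone K"
  using K by (auto simp: shrink_def)

lemma shrink_1: "shrink K 1 = K"
  using recession_cone_add[OF K] zero_in_recession_cone[OF K]
  by (auto simp: shrink_def) (metis add.right_neutral)

lemma shrink_add: "y \<in> shrink K t \<Longrightarrow> r \<in> recession_cone K \<Longrightarrow> y + r \<in> shrink K t"
  unfolding shrink_def using recession_cone_sum[OF K] by (clarsimp simp: add.assoc) metis

lemma scaleR_in_shrink: "k \<in> K \<Longrightarrow> t *\<^sub>R k \<in> shrink K t"
  unfolding shrink_def using zero_in_recession_cone[OF K] by (metis (mono_tags, lifting) add.right_neutral mem_Collect_eq)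

lemma shrink_subset:
  assumes "closed C" "convex C" "Convex.cone C" "K \<subseteq> C" "0 \<le> t"
  shows "shrink K t \<subseteq> C"
proof -
  have "x + y \<in> C" if "x \<in> C" "y \<in> C" for x y using that assms convex_cone[of C] by simp
  then show ?thesis
    using recession_cone_subset[OF K assms(1,3,4)] assms(3-5)
    by (auto simp: shrink_def subset_iff mem_cone)
qed

lemma shrink_scaleR:
  assumes "y \<in> shrink K t" "0 \<le> c"
  shows "c *\<^sub>R y \<in> shrink K (c * t)"
proof -
  obtain k r where "k \<in> K" "r \<in> recession_cone K" "y = t *\<^sub>R k + r"
    using assms(1) by (auto simp: shrink_def)
  moreover have "c *\<^sub>R r \<in> recession_cone K"
    using recession_cone_scaleR[OF K \<open>r \<in> _\<close> assms(2)] .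
  ultimately show ?thesis
    unfolding shrink_def by (auto simp: scaleR_right_distrib)
qed

lemma convex_shrink: "convex (shrink K t)"
proof -
  have "shrink K t = (\<Union>x\<in>(*\<^sub>R) t ` K. \<Union>y\<in>recession_cone K. {x + y})"
    by (auto simp: shrink_def)
  also have "convex \<dots>"
    using convex_sums[OF convex_scaling[OF K(2)] convex_recession_cone[OF K]]
    by (simp add: set_plus_def)
  finally show ?thesis .
qed

text \<open>Convex combinations with a fixed \<open>k0 \<in> K\<close> treat \<open>t = 0\<close> and \<open>t > 0\<close> alike.\<close>

lemma shrink_ray:
  assumes "y \<in> shrink K t" "k0 \<in> K" "0 \<le> t" "0 \<le> s" "s * t \<le> 1"
  shows "(1 - s * t) *\<^sub>R k0 + s *\<^sub>R y \<in> K"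
proof -
  obtain k r where k: "k \<in> K" "r \<in> recession_cone K" "y = t *\<^sub>R k + r"
    using assms(1) by (auto simp: shrink_def)
  have "((1 - s * t) *\<^sub>R k0 + (s * t) *\<^sub>R k) + s *\<^sub>R r \<in> K"
  proof (rule recession_cone_add[OF K])
    show "(1 - s * t) *\<^sub>R k0 + (s * t) *\<^sub>R k \<in> K"
      using assms by (intro convexD_alt[OF K(2) assms(2) k(1)]) auto
    show "s *\<^sub>R r \<in> recession_cone K" by (rule recession_cone_scaleR[OF K k(2) assms(4)])
  qed
  then show ?thesis using k(3) by (simp add: algebra_simps)
qed

text \<open>For \<open>a \<ge> 0\<close> the points \<open>(1 - a * s n) k0 + a * w n\<close> lie in
  \<open>K\<close> once \<open>a * s n < 1\<close>, by \<open>shrink_ray\<close>, and tend to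
  \<open>k0 + a y\<close>. No rate for \<open>s\<close> is involved.\<close>

lemma shrink_limit_recession:
  assumes t: "s \<longlonglongrightarrow> 0" "\<And>n. 0 \<le> s n" and w: "\<And>n. w n \<in> shrink K (s n)" "w \<longlonglongrightarrow> y"
  shows "y \<in> recession_cone K"
proof -
  obtain k0 where k0: "k0 \<in> K" using K by blast
  have "k0 + a *\<^sub>R y \<in> K" if a: "a \<ge> 0" for a
  proof -
    have as: "(\<lambda>n. a * s n) \<longlonglongrightarrow> a * 0" by (intro tendsto_intros t)
    have "(\<lambda>n. (1 - a * s n) *\<^sub>R k0 + a *\<^sub>R w n) \<longlonglongrightarrow> (1 - a * 0) *\<^sub>R k0 + a *\<^sub>R y"
      by (intro tendsto_intros as w)
    moreover have "\<forall>\<^sub>F n in sequentially. a * s n < 1"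
      using order_tendstoD(2)[OF as] by simp
    then have "\<forall>\<^sub>F n in sequentially. (1 - a * s n) *\<^sub>R k0 + a *\<^sub>R w n \<in> K"
      by eventually_elim (use shrink_ray[OF w(1) k0 t(2) a] in auto)
    ultimately show ?thesis using Lim_in_closed_set[OF K(1)] by fastforce
  qed
  then show ?thesis using recession_cone_iff[OF K(1,2) k0] by blast
qed

text \<open>At \<open>t = 0\<close> this is the preceding limit. For \<open>t > 0\<close>,
  \<open>shrink_ray\<close> with factor \<open>inverse (s n)\<close> gives \<open>k0\<close> weight
  zero, so \<open>w n / s n\<close> is eventually in the closed set \<open>K\<close>.\<close>

lemma shrink_closed_graph:
  assumes s: "s \<longlonglongrightarrow> t" "\<And>n. 0 \<le> s n" "0 \<le> t" and w: "\<And>n. w n \<in> shrink K (s n)" "w \<longlonglongrightarrow> y"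
  shows "y \<in> shrink K t"
proof (cases "t = 0")
  case True
  then show ?thesis using shrink_limit_recession s w shrink_0 by blast
next
  case False
  then have t: "t > 0" using s by simp
  obtain k0 where k0: "k0 \<in> K" using K by blast
  have "\<forall>\<^sub>F n in sequentially. 0 < s n" using order_tendstoD(1)[OF s(1) t] .
  then have "\<forall>\<^sub>F n in sequentially. w n /\<^sub>R s n \<in> K"
  proof eventually_elim
    case (elim n)
    then show ?case using shrink_ray[OF w(1) k0 s(2), of "inverse (s n)" n] by simp
  qed
  moreover have "(\<lambda>n. w n /\<^sub>R s n) \<longlonglongrightarrow> y /\<^sub>R t"
    using t by (intro tendsto_intros s w) auto
  ultimately have "y /\<^sub>R t \<in> K" by (rule Lim_in_closed_set[OF K(1) _ trivial_limit_sequentially])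
  then show ?thesis using scaleR_in_shrink[of "y /\<^sub>R t" t] t by simp
qed

lemma continuous_on_closest_point_shrink:
  "continuous_on ({0..1} \<times> cball 0 M) (\<lambda>(t, z). closest_point (shrink K t) z)"
proof -
  obtain k0 where k0: "k0 \<in> K" using K by blast
  show ?thesis
  proof (rule continuous_on_closest_point_family[where B = "norm k0"])
    fix t y assume t: "t \<in> {0..1::real}" 
    assume "y \<in> shrink K t"
    then obtain k r where "k \<in> K" "r \<in> recession_cone K" "y = t *\<^sub>R k + r" by (auto simp: shrink_def)
    \<comment> \<open>Fixing \<open>k\<close> and \<open>r\<close> while the factor varies gives a
      continuous selection through \<open>y\<close>.\<close>
    then show "\<exists>h. continuous_on {0..1} h \<and> h t = y \<and> (\<forall>s\<in>{0..1}. h s \<in> shrink K s)"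
      by (intro exI[of _ "\<lambda>s. s *\<^sub>R k + r"]) (auto simp: shrink_def intro!: continuous_intros)
  next
    fix t assume t: "t \<in> {0..1::real}" 
    show "\<exists>y\<in>shrink K t. norm y \<le> norm k0"
      using scaleR_in_shrink[OF k0, of t] t by (intro bexI[of _ "t *\<^sub>R k0"]) (auto simp: mult_left_le_one_le)
  next
    show "y \<in> shrink K t"
      if "t \<in> {0..1}" "\<forall>n. s n \<in> {0..1}" "s \<longlonglongrightarrow> t" "\<forall>n. w n \<in> shrink K (s n)" "w \<longlonglongrightarrow> y" for t y s w
      using shrink_closed_graph[OF that(3) _ _ _ that(5)] that by auto
  qed (use convex_shrink in auto)
qed

lemma closed_shrink: "0 \<le> t \<Longrightarrow> closed (shrink K t)"
  unfolding closed_sequential_limits using shrink_closed_graph[of "\<lambda>_. t" t] by auto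

lemma shrink_nonempty: "shrink K t \<noteq> {}"
  using scaleR_in_shrink K by blast

end

section \<open>Natural maps and their zeros\<close>

definition natural_map :: "'a::euclidean_space set \<Rightarrow> ('a \<Rightarrow> 'a) \<Rightarrow> ('a \<Rightarrow> 'a) \<Rightarrow> 'a \<Rightarrow> 'a" where
  "natural_map S \<phi> \<psi> x = \<psi> x - closest_point S (\<psi> x - \<phi> x)"

text \<open>A zero means that \<open>\<psi> x\<close> is its own projection after the shift by
  \<open>- \<phi> x\<close>; the obtuse angle condition for that projection is the variational
  inequality.\<close>

lemma natural_map_eq_0_iff:
  assumes "closed S" "convex S" "S \<noteq> {}"
  shows "natural_map S \<phi> \<psi> x = 0 \<longleftrightarrow> \<psi> x \<in> S \<and> (\<forall>y\<in>S. 0 \<le> \<phi> x \<bullet> (y - \<psi> x))"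
proof
  assume "natural_map S \<phi> \<psi> x = 0"
  then have eq: "closest_point S (\<psi> x - \<phi> x) = \<psi> x" by (simp add: natural_map_def)
  then show "\<psi> x \<in> S \<and> (\<forall>y\<in>S. 0 \<le> \<phi> x \<bullet> (y - \<psi> x))"
    using closest_point_in_set[OF assms(1,3), of "\<psi> x - \<phi> x"]
      closest_point_dot[OF assms(2,1), of _ "\<psi> x - \<phi> x"] by auto
next
  assume "\<psi> x \<in> S \<and> (\<forall>y\<in>S. 0 \<le> \<phi> x \<bullet> (y - \<psi> x))"
  then have "closest_point S (\<psi> x - \<phi> x) = \<psi> x"
    using assms by (intro closest_point_eqI) auto
  then show "natural_map S \<phi> \<psi> x = 0" by (simp add: natural_map_def)
qed

text \<open>The preimage condition makes membership in \<open>D\<close> automatic, so zeros found in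
  the whole space are solutions on \<open>D\<close> and the values of an extension outside
  \<open>D\<close> add none.\<close>

lemma SOL_eq_natural_map:
  assumes "closed S" "convex S" "S \<noteq> {}" "\<psi> -` S \<subseteq> D"
  shows "SOL D \<phi> \<psi> S = {x. natural_map S \<phi> \<psi> x = 0}"
  using assms by (auto simp: SOL_def natural_map_eq_0_iff)

section \<open>Asymptotics of weakly homogeneous maps and boundedness of zeros\<close>

text \<open>The scaled remainder vanishes by definition, and homogeneity moves the scaling inside
  \<open>h\<close>, where continuity at the limit direction \<open>u \<in> D\<close>
  applies.\<close>

lemma weakly_homogeneous_on_tendsto:
  fixes \<phi> h :: "'a::euclidean_space \<Rightarrow> 'a"
  assumes D: "closed D" "Convex.cone D" and wh: "weakly_homogeneous_on D \<delta> \<phi> h"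
    and x: "\<And>n::nat. x n \<in> D" "filterlim (\<lambda>n. norm (x n)) at_top sequentially"
    and u: "(\<lambda>n. x n /\<^sub>R norm (x n)) \<longlonglongrightarrow> u"
  shows "(\<lambda>n. \<phi> (x n) /\<^sub>R (norm (x n) powr \<delta>)) \<longlonglongrightarrow> h u"
proof -
  have xD: "x n /\<^sub>R norm (x n) \<in> D" for n using D(2) x(1) by (simp add: mem_cone)
  have uD: "u \<in> D" using closed_sequentially[OF D(1) xD u] .
  have h: "continuous_on D h" "\<And>x l. x \<in> D \<Longrightarrow> l > 0 \<Longrightarrow> h (l *\<^sub>R x) = (l powr \<delta>) *\<^sub>R h x"
    using wh by (auto simp: weakly_homogeneous_on_def pos_homogeneous_on_def)
  have "filterlim x (inf at_infinity (principal D)) sequentially"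
    using x by (auto simp: filterlim_inf filterlim_principal intro: filterlim_norm_at_top_imp_at_infinity)
  then have rem: "(\<lambda>n. (\<phi> (x n) - h (x n)) /\<^sub>R (norm (x n) powr \<delta>)) \<longlonglongrightarrow> 0"
    using wh unfolding weakly_homogeneous_on_def by (auto elim: filterlim_compose)
  have lead: "(\<lambda>n. h (x n /\<^sub>R norm (x n))) \<longlonglongrightarrow> h u"
    by (rule continuous_on_tendsto_compose[OF h(1) u uD]) (use xD in auto)
  have "\<forall>\<^sub>F n in sequentially. 0 < norm (x n)"
    using x(2)[unfolded filterlim_at_top_dense] by blast
  then have "\<forall>\<^sub>F n in sequentially. (\<phi> (x n) - h (x n)) /\<^sub>R (norm (x n) powr \<delta>) + h (x n /\<^sub>R norm (x n))
      = \<phi> (x n) /\<^sub>R (norm (x n) powr \<delta>)"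
  proof eventually_elim
    case (elim n)
    have "h (x n /\<^sub>R norm (x n)) = (inverse (norm (x n)) powr \<delta>) *\<^sub>R h (x n)"
      by (rule h(2)) (use elim x in auto)
    also have "inverse (norm (x n)) powr \<delta> = inverse (norm (x n) powr \<delta>)"
      using elim by (simp add: inverse_powr)
    finally show ?case by (simp add: scaleR_diff_right)
  qed
  from Lim_transform_eventually[OF _ this] show ?thesis using tendsto_add[OF rem lead] by simp
qed

text \<open>The weights need not converge: both scaled maps have the limit \<open>h u\<close>, so
  their difference tends to 0 even after multiplication by bounded weights.\<close>

lemma weakly_homogeneous_on_convex_tendsto:
  fixes \<phi>0 \<phi>1 h :: "'a::euclidean_space \<Rightarrow> 'a"
  assumes D: "closed D" "Convex.cone D"
    and wh: "weakly_homogeneous_on D \<delta> \<phi>0 h" "weakly_homogeneous_on D \<delta> \<phi>1 h"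
    and x: "\<And>n::nat. x n \<in> D" "filterlim (\<lambda>n. norm (x n)) at_top sequentially"
    and u: "(\<lambda>n. x n /\<^sub>R norm (x n)) \<longlonglongrightarrow> u"
    and t: "\<And>n. t n \<in> {0..1}"
  shows "(\<lambda>n. ((1 - t n) *\<^sub>R \<phi>0 (x n) + t n *\<^sub>R \<phi>1 (x n)) /\<^sub>R (norm (x n) powr \<delta>)) \<longlonglongrightarrow> h u"
proof -
  define a where "a \<phi> n = \<phi> (x n) /\<^sub>R (norm (x n) powr \<delta>)" for \<phi> :: "'a \<Rightarrow> 'a" and n
  have a: "a \<phi>0 \<longlonglongrightarrow> h u" "a \<phi>1 \<longlonglongrightarrow> h u"
    using weakly_homogeneous_on_tendsto[OF D _ x u] wh unfolding a_def by auto
  have "(\<lambda>n. t n *\<^sub>R (a \<phi>1 n - a \<phi>0 n)) \<longlonglongrightarrow> 0"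
  proof (rule Lim_null_comparison)
    show "\<forall>\<^sub>F n in sequentially. norm (t n *\<^sub>R (a \<phi>1 n - a \<phi>0 n)) \<le> norm (a \<phi>1 n - a \<phi>0 n)"
      using t by (intro always_eventually) (auto simp: mult_left_le_one_le)
    show "(\<lambda>n. norm (a \<phi>1 n - a \<phi>0 n)) \<longlonglongrightarrow> 0"
      using tendsto_norm[OF tendsto_diff[OF a(2) a(1)]] by simp
  qed
  then have "(\<lambda>n. a \<phi>0 n + t n *\<^sub>R (a \<phi>1 n - a \<phi>0 n)) \<longlonglongrightarrow> h u + 0"
    by (intro tendsto_add a)
  then show ?thesis by (simp add: a_def algebra_simps)
qed

text \<open>\<open>F0\<close> and \<open>F1\<close> have the leading term \<open>finf\<close> only
  on \<open>C\<close>; \<open>esc\<close> places zeros of large norm there. Scaling by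
  \<open>norm x powr \<delta>\<^sub>2\<close> drives the parameter of the moving set to 0, so the
  limit of the scaled \<open>g\<close>-values is in the recession cone whatever the parameters
  do.\<close>

lemma homotopy_zeros_bounded:
  fixes C K :: "'a::euclidean_space set"
  assumes C: "closed C" "convex C" "Convex.cone C"
    and K: "closed K" "convex K" "K \<noteq> {}" "K \<subseteq> C"
    and F: "weakly_homogeneous_on C \<delta>\<^sub>1 F0 finf" "weakly_homogeneous_on C \<delta>\<^sub>1 F1 finf"
    and g: "weakly_homogeneous_on UNIV \<delta>\<^sub>2 g0 ginf" "weakly_homogeneous_on UNIV \<delta>\<^sub>2 g1 ginf"
    and inf: "SOL C finf ginf (recession_cone K) \<subseteq> {0}"
    and esc: "\<forall>\<^sub>F x in at_infinity. \<forall>t\<in>{0..1}. (1 - t) *\<^sub>R g0 x + t *\<^sub>R g1 x \<in> C \<longrightarrow> x \<in> C"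
  obtains r where "\<And>t x. t \<in> {0..1} \<Longrightarrow>
     natural_map (shrink K t) (\<lambda>x. (1 - t) *\<^sub>R F0 x + t *\<^sub>R F1 x) (\<lambda>x. (1 - t) *\<^sub>R g0 x + t *\<^sub>R g1 x) x = 0
     \<Longrightarrow> norm x < r"
proof (rule ccontr)
  note K3 = K(1-3)
  define F where "F t x = (1 - t) *\<^sub>R F0 x + t *\<^sub>R F1 x" for t x
  define g where "g t x = (1 - t) *\<^sub>R g0 x + t *\<^sub>R g1 x" for t x
  obtain r0 where r0: "\<And>x t. r0 \<le> norm x \<Longrightarrow> t \<in> {0..1} \<Longrightarrow> g t x \<in> C \<Longrightarrow> x \<in> C"
    using esc unfolding eventually_at_infinity g_def by blast
  assume "\<not> thesis"
  then have "\<exists>t x. t \<in> {0..1} \<and> natural_map (shrink K t) (F t) (g t) x = 0 \<and> r \<le> norm x" for r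
    using that unfolding F_def g_def by (metis linorder_not_less)
  \<comment> \<open>The bound \<open>r0\<close> makes \<open>esc\<close> available at every index,
    and \<open>real n\<close> forces the norms to infinity.\<close>
  then have "\<exists>t x. t \<in> {0..1} \<and> natural_map (shrink K t) (F t) (g t) x = 0 \<and> max r0 (real n) \<le> norm x" for n :: nat
    by blast
  then obtain t0 x0 where 0: "\<And>n. t0 n \<in> {0..1}"
      "\<And>n. natural_map (shrink K (t0 n)) (F (t0 n)) (g (t0 n)) (x0 n) = 0"
      "\<And>n. max r0 (real n) \<le> norm (x0 n)"
    by metis
  \<comment> \<open>The quotient is 0 when \<open>x0 n = 0\<close>, hence the ball rather than the
    sphere; \<open>norm u = 1\<close> is recovered at the end.\<close>
  have "\<forall>n. x0 n /\<^sub>R norm (x0 n) \<in> cball 0 1"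
  proof
    show "x0 n /\<^sub>R norm (x0 n) \<in> cball 0 1" for n by (cases "x0 n = 0") auto
  qed
  then obtain u \<rho> where "u \<in> cball 0 1" and \<rho>: "strict_mono (\<rho> :: nat \<Rightarrow> nat)"
    and u0: "((\<lambda>n. x0 n /\<^sub>R norm (x0 n)) \<circ> \<rho>) \<longlonglongrightarrow> u"
    by (rule seq_compactE[OF compact_imp_seq_compact[OF compact_cball]])
  define x where "x n = x0 (\<rho> n)" for n
  define t where "t n = t0 (\<rho> n)" for n
  have u: "(\<lambda>n. x n /\<^sub>R norm (x n)) \<longlonglongrightarrow> u" using u0 by (simp add: x_def o_def)
  have t: "t n \<in> {0..1}" for n using 0(1) by (simp add: t_def)
  have nx: "real n \<le> norm (x n)" "r0 \<le> norm (x n)" for n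
    using 0(3)[of "\<rho> n"] seq_suble[OF \<rho>, of n] by (auto simp: x_def intro: order_trans)
  have lim: "filterlim (\<lambda>n. norm (x n)) at_top sequentially"
    using nx(1) by (intro filterlim_at_top_mono[OF filterlim_real_sequentially]) auto
  have sol: "g (t n) (x n) \<in> shrink K (t n)"
      "\<And>y. y \<in> shrink K (t n) \<Longrightarrow> 0 \<le> F (t n) (x n) \<bullet> (y - g (t n) (x n))" for n
    using 0(2)[of "\<rho> n"] t[of n]
      natural_map_eq_0_iff[OF closed_shrink[OF K3] convex_shrink[OF K3] shrink_nonempty[OF K3], of "t n"]
    by (auto simp: x_def t_def)
  have xC: "x n \<in> C" for n
    using r0[OF nx(2) t] sol(1)[of n] shrink_subset[OF K3 C K(4), of "t n"] t[of n] by auto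
  have uC: "u \<in> C"
    by (rule closed_sequentially[OF C(1) _ u]) (use xC C in \<open>simp add: mem_cone\<close>)
  have Flim: "(\<lambda>n. F (t n) (x n) /\<^sub>R (norm (x n) powr \<delta>\<^sub>1)) \<longlonglongrightarrow> finf u"
    unfolding F_def using weakly_homogeneous_on_convex_tendsto[OF C(1,3) F xC lim u t] .
  have glim: "(\<lambda>n. g (t n) (x n) /\<^sub>R (norm (x n) powr \<delta>\<^sub>2)) \<longlonglongrightarrow> ginf u"
    unfolding g_def
    using weakly_homogeneous_on_convex_tendsto[OF _ _ g _ lim u t] by (simp add: Convex.cone_def)
  have "\<delta>\<^sub>2 > 0" using g by (simp add: weakly_homogeneous_on_def)
  then have p0: "(\<lambda>n. norm (x n) powr (- \<delta>\<^sub>2)) \<longlonglongrightarrow> 0"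
    using tendsto_neg_powr[OF _ lim, of "- \<delta>\<^sub>2"] by simp
  have s0: "(\<lambda>n. inverse (norm (x n) powr \<delta>\<^sub>2) * t n) \<longlonglongrightarrow> 0"
  proof (rule Lim_null_comparison[OF always_eventually p0], intro allI)
    fix n
    show "norm (inverse (norm (x n) powr \<delta>\<^sub>2) * t n) \<le> norm (x n) powr (- \<delta>\<^sub>2)"
      using t[of n] mult_left_le[of "t n" "inverse (norm (x n) powr \<delta>\<^sub>2)"]
      by (simp add: powr_minus abs_mult)
  qed
  \<comment> \<open>Scaling a point of \<open>shrink K t\<close> by \<open>c\<close> scales its
    parameter to \<open>c * t\<close>, which here tends to 0.\<close>
  have gR: "ginf u \<in> recession_cone K"
  proof (rule shrink_limit_recession[OF K3 s0 _ _ glim])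
    show "0 \<le> inverse (norm (x n) powr \<delta>\<^sub>2) * t n" for n using t[of n] by simp
    show "g (t n) (x n) /\<^sub>R norm (x n) powr \<delta>\<^sub>2 \<in> shrink K (inverse (norm (x n) powr \<delta>\<^sub>2) * t n)" for n
      by (intro shrink_scaleR[OF K3] sol) simp
  qed
  \<comment> \<open>Moving \<open>g (t n) (x n)\<close> by a recession direction \<open>y\<close>
    stays in the set, so the inequality may be tested there and leaves only
    \<open>y\<close>.\<close>
  have dual: "0 \<le> finf u \<bullet> y" if y: "y \<in> recession_cone K" for y
  proof -
    have "(\<lambda>n. (F (t n) (x n) /\<^sub>R (norm (x n) powr \<delta>\<^sub>1)) \<bullet> y) \<longlonglongrightarrow> finf u \<bullet> y"
      by (intro tendsto_intros Flim)
    moreover have "0 \<le> (F (t n) (x n) /\<^sub>R (norm (x n) powr \<delta>\<^sub>1)) \<bullet> y" for n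
      using sol(2)[OF shrink_add[OF K3 sol(1) y], of n] by simp
    ultimately show ?thesis by (meson LIMSEQ_le_const)
  qed
  \<comment> \<open>The test point \<open>t n *\<^sub>R k0\<close> disappears after scaling.
    \<open>F\<close> and \<open>g\<close> are scaled by their own powers of the norm, whose product
    is positive and preserves the inequality.\<close>
  have "finf u \<bullet> ginf u \<le> 0"
  proof -
    obtain k0 where k0: "k0 \<in> K" using K by blast
    have "(\<lambda>n. (F (t n) (x n) /\<^sub>R (norm (x n) powr \<delta>\<^sub>1)) \<bullet>
        ((inverse (norm (x n) powr \<delta>\<^sub>2) * t n) *\<^sub>R k0 - g (t n) (x n) /\<^sub>R (norm (x n) powr \<delta>\<^sub>2)))
        \<longlonglongrightarrow> finf u \<bullet> (0 *\<^sub>R k0 - ginf u)"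
      by (intro tendsto_intros Flim glim s0)
    moreover have "0 \<le> (F (t n) (x n) /\<^sub>R (norm (x n) powr \<delta>\<^sub>1)) \<bullet>
        ((inverse (norm (x n) powr \<delta>\<^sub>2) * t n) *\<^sub>R k0 - g (t n) (x n) /\<^sub>R (norm (x n) powr \<delta>\<^sub>2))" for n
    proof -
      have "0 \<le> inverse (norm (x n) powr \<delta>\<^sub>1) * inverse (norm (x n) powr \<delta>\<^sub>2) *
          (F (t n) (x n) \<bullet> (t n *\<^sub>R k0 - g (t n) (x n)))"
        using sol(2)[OF scaleR_in_shrink[OF K3 k0], of n] by simp
      then show ?thesis by (simp add: inner_diff_right algebra_simps)
    qed
    ultimately have "0 \<le> finf u \<bullet> (0 *\<^sub>R k0 - ginf u)" by (meson LIMSEQ_le_const)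
    then show ?thesis by simp
  qed
  then have "u \<in> SOL C finf ginf (recession_cone K)"
    using uC gR dual by (force simp: SOL_def inner_diff_right)
  then have "u = 0" using inf by blast
  moreover have "norm u = 1"
  proof -
    have "\<forall>\<^sub>F n in sequentially. 1 = norm (x n /\<^sub>R norm (x n))"
      using lim[unfolded filterlim_at_top_dense, rule_format, of 0] by eventually_elim simp
    then have "(\<lambda>n. norm (x n /\<^sub>R norm (x n))) \<longlonglongrightarrow> 1"
      by (rule Lim_transform_eventually[OF tendsto_const])
    then show ?thesis using tendsto_norm[OF u] LIMSEQ_unique by blast
  qed
  ultimately show False by simp
qed

section \<open>Auxiliary facts on dual cones, degree and weak homogeneity\<close>

lemma closed_dual_cone: "closed (dual_cone S)"
proof -
  have "dual_cone S = (\<Inter>x\<in>S. {u. 0 \<le> u \<bullet> x})" by (auto simp: dual_cone_def)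
  moreover have "closed {u. 0 \<le> u \<bullet> x}" for x :: 'a
    by (intro closed_Collect_le continuous_intros)
  ultimately show ?thesis by auto
qed

text \<open>A segment leaving \<open>S\<close> meets the frontier at a point no farther from
  \<open>d\<close> than \<open>norm z\<close>. The same argument covers an empty frontier, at
  distance \<infinity>.\<close>

lemma add_in_closed_set:
  fixes d z :: "'a::euclidean_space"
  assumes "d \<in> S" "closed S" "ereal (norm z) < set_dist d (frontier S)"
  shows "d + z \<in> S"
proof (rule ccontr)
  assume "d + z \<notin> S"
  then have "closed_segment d (d + z) \<inter> frontier S \<noteq> {}"
    using assms(1) by (intro connected_Int_frontier) auto
  then obtain s where s: "s \<in> closed_segment d (d + z)" "s \<in> frontier S" by blast
  have "set_dist d (frontier S) \<le> ereal (dist d s)"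
    unfolding set_dist_def using s(2) by (rule INF_lower)
  also have "dist d s \<le> norm z"
    using dist_in_closed_segment[OF s(1)] by (simp add: dist_norm norm_minus_commute)
  finally show False using assms(3) by simp
qed

text \<open>Agreement on the closure makes the frontier images coincide, and with them the radius in
  the definition of the degree.\<close>

lemma brouwer_degree_cong:
  assumes "\<And>x. x \<in> closure \<Omega> \<Longrightarrow> \<phi> x = \<psi> x"
  shows "brouwer_degree \<phi> \<Omega> b = brouwer_degree \<psi> \<Omega> b"
proof -
  have "collapse_map e \<phi> \<Omega> b = collapse_map e \<psi> \<Omega> b" for e
    using assms closure_subset[of \<Omega>] by (auto simp: collapse_map_def fun_eq_iff subset_iff)
  moreover have "\<phi> ` frontier \<Omega> = \<psi> ` frontier \<Omega>"
    using assms by (intro image_cong) (auto simp: frontier_def)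
  moreover have "continuous_on (closure \<Omega>) \<phi> = continuous_on (closure \<Omega>) \<psi>"
    using assms by (intro continuous_on_cong) auto
  ultimately show ?thesis by (simp add: brouwer_degree_def)
qed

lemma SOL_cong:
  assumes "\<And>x. x \<in> D \<Longrightarrow> \<phi> x = \<phi>' x"
  shows "SOL D \<phi> \<psi> S = SOL D \<phi>' \<psi> S"
  using assms by (auto simp: SOL_def)

lemma WHGCP_eq_SOL:
  assumes "Convex.cone S" "convex S"
  shows "WHGCP D f g S = SOL D f g S"
proof -
  have "(f x \<in> dual_cone S \<and> f x \<bullet> g x = 0) \<longleftrightarrow> (\<forall>y\<in>S. 0 \<le> f x \<bullet> (y - g x))" if gS: "g x \<in> S" for x
  proof
    assume "f x \<in> dual_cone S \<and> f x \<bullet> g x = 0"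
    then show "\<forall>y\<in>S. 0 \<le> f x \<bullet> (y - g x)" by (simp add: dual_cone_def inner_diff_right)
  next
    assume vi: "\<forall>y\<in>S. 0 \<le> f x \<bullet> (y - g x)"
    \<comment> \<open>The test points 0 and \<open>2 g x\<close> bound the inner product from both
      sides.\<close>
    have "0 *\<^sub>R g x \<in> S" "2 *\<^sub>R g x \<in> S" using assms(1) gS by (simp_all only: mem_cone)
    with vi have "0 \<le> f x \<bullet> (0 *\<^sub>R g x - g x)" "0 \<le> f x \<bullet> (2 *\<^sub>R g x - g x)" by blast+
    then have 0: "f x \<bullet> g x = 0" by (simp add: inner_diff_right)
    with vi show "f x \<in> dual_cone S \<and> f x \<bullet> g x = 0"
      by (simp add: dual_cone_def inner_diff_right)
  qed
  then show ?thesis by (auto simp: WHGCP_def SOL_def)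
qed

lemma weakly_homogeneous_on_imp_continuous:
  assumes "weakly_homogeneous_on D \<delta> \<phi> h"
  shows "continuous_on D \<phi>"
proof -
  have "continuous_on D (\<lambda>x. \<phi> x - h x)" "continuous_on D h"
    using assms by (auto simp: weakly_homogeneous_on_def pos_homogeneous_on_def)
  then have "continuous_on D (\<lambda>x. (\<phi> x - h x) + h x)" by (rule continuous_on_add)
  then show ?thesis by simp
qed

text \<open>Since \<open>\<delta> > 0\<close>, a constant is negligible against the power of the
  norm. Asking for the relation only on \<open>D\<close> lets continuous extensions qualify.\<close>

lemma weakly_homogeneous_on_add_const:
  assumes "weakly_homogeneous_on D \<delta> \<phi> h" "\<And>x. x \<in> D \<Longrightarrow> \<psi> x = \<phi> x + c"
  shows "weakly_homogeneous_on D \<delta> \<psi> h"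
proof -
  have \<delta>: "\<delta> > 0" using assms(1) by (simp add: weakly_homogeneous_on_def)
  let ?F = "inf at_infinity (principal D)"
  have "((\<lambda>x::'a. norm x powr (- \<delta>)) \<longlongrightarrow> 0) at_infinity"
    using tendsto_neg_powr[OF _ filterlim_norm_at_top, of "- \<delta>"] \<delta> by simp
  then have "((\<lambda>x::'a. norm x powr (- \<delta>)) \<longlongrightarrow> 0) ?F"
    by (rule tendsto_mono[OF inf_le1])
  then have c: "((\<lambda>x. (norm x powr (- \<delta>)) *\<^sub>R c) \<longlongrightarrow> 0 *\<^sub>R c) ?F"
    by (intro tendsto_intros)
  have rem: "((\<lambda>x. (\<phi> x - h x) /\<^sub>R (norm x powr \<delta>)) \<longlongrightarrow> 0) ?F"
    using assms(1) by (simp add: weakly_homogeneous_on_def)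
  have "((\<lambda>x. (\<phi> x - h x) /\<^sub>R (norm x powr \<delta>) + (norm x powr (- \<delta>)) *\<^sub>R c) \<longlongrightarrow> 0) ?F"
    using tendsto_add[OF rem c] by simp
  then have "((\<lambda>x. (\<psi> x - h x) /\<^sub>R (norm x powr \<delta>)) \<longlongrightarrow> 0) ?F"
  proof (rule Lim_transform_eventually)
    show "\<forall>\<^sub>F x in ?F. (\<phi> x - h x) /\<^sub>R (norm x powr \<delta>) + (norm x powr (- \<delta>)) *\<^sub>R c
        = (\<psi> x - h x) /\<^sub>R (norm x powr \<delta>)"
      unfolding eventually_inf_principal
      by (intro always_eventually) (simp add: assms(2) powr_minus algebra_simps)
  qed
  moreover have "continuous_on D (\<lambda>x. (\<phi> x - h x) + c)"
    using assms(1) by (intro continuous_on_add continuous_on_const) (simp add: weakly_homogeneous_on_def)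
  then have "continuous_on D (\<lambda>x. \<psi> x - h x)"
    by (rule continuous_on_eq) (simp add: assms(2))
  ultimately show ?thesis using assms(1) by (simp add: weakly_homogeneous_on_def)
qed

lemma weakly_homogeneous_on_leading_term:
  assumes "weakly_homogeneous_on D \<delta> \<phi> h"
  shows "weakly_homogeneous_on D \<delta> h h"
  using assms by (simp add: weakly_homogeneous_on_def)

section \<open>The homotopy and the degree argument\<close>

text \<open>The projections are jointly continuous on balls; compactness of \<open>S\<close> bounds
  the projected points \<open>g - F\<close> and so provides a ball.\<close>

lemma continuous_on_natural_map_homotopy:
  fixes K :: "'a::euclidean_space set"
  assumes K: "closed K" "convex K" "K \<noteq> {}"
    and F: "continuous_on ({0..1} \<times> S) (\<lambda>(t, x). F t x)"
    and g: "continuous_on ({0..1} \<times> S) (\<lambda>(t, x). g t x)"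
    and S: "compact S"
  shows "continuous_on ({0..1} \<times> S) (\<lambda>(t, x). natural_map (shrink K t) (F t) (g t) x)"
proof -
  define z where "z p = (case p of (t, x) \<Rightarrow> g t x) - (case p of (t, x) \<Rightarrow> F t x)" for p
  have z: "continuous_on ({0..1} \<times> S) z"
    unfolding z_def by (intro continuous_on_diff F g)
  have "bounded (z ` ({0..1} \<times> S))"
    by (intro compact_imp_bounded compact_continuous_image z compact_Times S compact_Icc)
  then obtain M where "\<forall>y\<in>z ` ({0..1} \<times> S). norm y \<le> M" unfolding bounded_iff by blast
  then have im: "(\<lambda>p. (fst p, z p)) ` ({0..1} \<times> S) \<subseteq> {0..1} \<times> cball 0 M" by auto
  have "continuous_on ({0..1} \<times> S) (\<lambda>p. (\<lambda>(t, z). closest_point (shrink K t) z) (fst p, z p))"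
    by (rule continuous_on_compose2[OF continuous_on_closest_point_shrink[OF K] _ im])
       (intro continuous_intros z)
  then have "continuous_on ({0..1} \<times> S)
      (\<lambda>p. (case p of (t, x) \<Rightarrow> g t x) - (\<lambda>(t, z). closest_point (shrink K t) z) (fst p, z p))"
    by (intro continuous_on_diff g)
  then show ?thesis
    by (rule continuous_on_eq) (auto simp: natural_map_def z_def)
qed

text \<open>One statement for both conditions and both target sets. The maps are continuous on the
  whole space because the degree is taken there; \<open>vim\<close> brings the zeros at the two ends
  back into \<open>C\<close>.\<close>

theorem SOL_nonempty_compact:
  fixes C K :: "'a::euclidean_space set"
  assumes C: "closed C" "convex C" "Convex.cone C"
    and K: "closed K" "convex K" "K \<noteq> {}" "K \<subseteq> C"
    and F: "weakly_homogeneous_on C \<delta>\<^sub>1 F0 finf" "weakly_homogeneous_on C \<delta>\<^sub>1 F1 finf"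
    and F_cont: "continuous_on UNIV F0" "continuous_on UNIV F1"
    and g: "weakly_homogeneous_on UNIV \<delta>\<^sub>2 g0 ginf" "weakly_homogeneous_on UNIV \<delta>\<^sub>2 g1 ginf"
    and inf: "SOL C finf ginf (recession_cone K) \<subseteq> {0}"
    and esc: "\<forall>\<^sub>F x in at_infinity. \<forall>t\<in>{0..1}. (1 - t) *\<^sub>R g0 x + t *\<^sub>R g1 x \<in> C \<longrightarrow> x \<in> C"
    and vim: "g0 -` C \<subseteq> C" "g1 -` C \<subseteq> C"
    and start: "SOL C F0 g0 (recession_cone K) = {0}"
    and \<Omega>: "bounded \<Omega>" "open \<Omega>"
    and dual: "\<And>x. x \<in> \<Omega> \<Longrightarrow> F0 x - g0 x \<in> dual_cone (recession_cone K)"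
    and deg: "brouwer_degree g0 \<Omega> 0 \<noteq> 0"
  shows "SOL C F1 g1 K \<noteq> {} \<and> compact (SOL C F1 g1 K)"
proof -
  note K3 = K(1-3)
  let ?R = "recession_cone K"
  note R = closed_recession_cone[OF K3] convex_recession_cone[OF K3] zero_in_recession_cone[OF K3]
  have Rne: "?R \<noteq> {}" using R(3) by blast
  have RC: "?R \<subseteq> C" by (rule recession_cone_subset[OF K3 C(1,3) K(4)])
  define F where "F t x = (1 - t) *\<^sub>R F0 x + t *\<^sub>R F1 x" for t x
  define g where "g t x = (1 - t) *\<^sub>R g0 x + t *\<^sub>R g1 x" for t x
  define h where "h t = natural_map (shrink K t) (F t) (g t)" for t
  have h0: "h 0 = natural_map ?R F0 g0" and h1: "h 1 = natural_map K F1 g1"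
    by (auto simp: h_def F_def g_def shrink_0[OF K3] shrink_1[OF K3] natural_map_def fun_eq_iff)
  have g_cont: "continuous_on UNIV g0" "continuous_on UNIV g1"
    using g weakly_homogeneous_on_imp_continuous by blast+
  obtain r where r: "\<And>t x. t \<in> {0..1} \<Longrightarrow> h t x = 0 \<Longrightarrow> norm x < r"
    unfolding h_def F_def g_def
    using homotopy_zeros_bounded[OF C K F g inf esc] by blast
  obtain b where b: "b > 0" "\<Omega> \<subseteq> ball 0 b" using bounded_subset_ballD[OF \<Omega>(1)] by blast
  \<comment> \<open>The ball of radius \<open>M\<close> contains \<open>\<Omega>\<close> and all
    zeros of the homotopy, so none lies on its boundary.\<close>
  define M where "M = max r b"
  have M: "r \<le> M" "0 < M" "\<Omega> \<subseteq> ball 0 M" using b by (auto simp: M_def)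
  have sol1: "SOL C F1 g1 K = {x. h 1 x = 0}"
    unfolding h1 using vim(2) K(4) by (intro SOL_eq_natural_map K3) auto
  have "SOL C F0 g0 ?R = {x. h 0 x = 0}"
    unfolding h0 using vim(1) RC by (intro SOL_eq_natural_map R Rne) auto
  then have sol0: "h 0 x = 0 \<longleftrightarrow> x = 0" for x using start by (auto simp: set_eq_iff)
  have h_cont: "continuous_on ({0..1} \<times> cball 0 M) (\<lambda>(t, x). h t x)"
    unfolding h_def
  proof (rule continuous_on_natural_map_homotopy[OF K3])
    show "continuous_on ({0..1} \<times> cball 0 M) (\<lambda>(t, x). F t x)"
      unfolding F_def case_prod_unfold
      by (intro continuous_intros continuous_on_compose2[OF F_cont(1)] continuous_on_compose2[OF F_cont(2)]) auto
    show "continuous_on ({0..1} \<times> cball 0 M) (\<lambda>(t, x). g t x)"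
      unfolding g_def case_prod_unfold
      by (intro continuous_intros continuous_on_compose2[OF g_cont(1)] continuous_on_compose2[OF g_cont(2)]) auto
  qed simp
  have h0_cont: "continuous_on (cball 0 M) (h 0)"
  proof -
    have "continuous_on (cball 0 M) (\<lambda>x. (\<lambda>(t, x). h t x) (0, x))"
      by (rule continuous_on_compose2[OF h_cont]) (auto intro!: continuous_intros)
    then show ?thesis by simp
  qed
  \<comment> \<open>\<open>dual\<close> extends to the closure because the dual cone is closed;
    there \<open>g0 x - F0 x\<close> is polar to the recession cone and projects to 0. The closure
    is needed for equality of degrees.\<close>
  have h0_eq: "h 0 x = g0 x" if "x \<in> closure \<Omega>" for x
  proof -
    have "closed ((\<lambda>x. F0 x - g0 x) -` dual_cone ?R)"
      by (intro closed_vimage closed_dual_cone continuous_on_diff F_cont g_cont)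
    moreover have "\<Omega> \<subseteq> (\<lambda>x. F0 x - g0 x) -` dual_cone ?R" using dual by auto
    ultimately have "F0 x - g0 x \<in> dual_cone ?R" using that closure_minimal by blast
    then have "closest_point ?R (g0 x - F0 x) = 0"
      by (intro closest_point_eqI R) (auto simp: dual_cone_def inner_diff_left)
    then show ?thesis by (simp add: h0 natural_map_def)
  qed
  \<comment> \<open>A zero of \<open>g0\<close> in \<open>\<Omega>\<close> is a zero of
    \<open>h 0\<close>, hence equals 0. So \<open>\<Omega>\<close> contains the only zero of
    \<open>h 0\<close>, as excision requires.\<close>
  obtain x where x: "x \<in> \<Omega>" "g0 x = 0" using brouwer_degree_solution[OF deg] by blast
  then have "h 0 x = 0" using h0_eq[of x] closure_subset[of \<Omega>] by auto
  then have "0 \<in> \<Omega>" using sol0 x(1) by simp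
  have "brouwer_degree (h 1) (ball 0 M) 0 = brouwer_degree (h 0) (ball 0 M) 0"
  proof (rule brouwer_degree_homotopy[symmetric])
    show "continuous_on ({0..1} \<times> closure (ball 0 M)) (\<lambda>(t, x). h t x)"
      using h_cont M(2) by simp
    show "h t x \<noteq> 0" if "t \<in> {0..1}" "x \<in> frontier (ball 0 M)" for t x
      using r[OF that(1), of x] that(2) M(1,2) by auto
  qed auto
  also have "\<dots> = brouwer_degree (h 0) \<Omega> 0"
    by (rule brouwer_degree_excision) (use h0_cont M \<Omega> sol0 \<open>0 \<in> \<Omega>\<close> in auto)
  also have "\<dots> = brouwer_degree g0 \<Omega> 0"
    using h0_eq by (rule brouwer_degree_cong)
  finally obtain y where "h 1 y = 0" using deg brouwer_degree_solution by metis
  moreover have "bounded {x. h 1 x = 0}"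
    using r[of 1] by (intro boundedI[of _ r]) (auto intro: less_imp_le)
  moreover have "closed {x. h 1 x = 0}"
    unfolding h1 natural_map_def
    by (intro closed_Collect_eq continuous_intros g_cont F_cont
        continuous_on_compose2[OF continuous_on_closest_point[OF K(2,1,3), of UNIV]]) auto
  ultimately show ?thesis by (auto simp: sol1 compact_eq_bounded_closed)
qed

section \<open>Verification of the two conditions\<close>

theorem mainTheorem8:
  fixes C K :: "'a::euclidean_space set"
    and f finf fbar g ginf gbar F Finf :: "'a \<Rightarrow> 'a"
    and p q :: 'a
    and \<delta>\<^sub>1 \<delta>\<^sub>2 :: real
  assumes C: "closed C" "convex C" "Convex.cone C"
    and K: "K \<noteq> {}" "closed K" "convex K" "K \<subseteq> C" "pointed (recession_cone K)"
    and f_wh: "weakly_homogeneous_on C \<delta>\<^sub>1 f finf"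
    and f_eq: "\<And>x. x \<in> C \<Longrightarrow> f x = finf x + fbar x + p"
    and g_wh: "weakly_homogeneous_on UNIV \<delta>\<^sub>2 g ginf"
    and g_eq: "\<And>x. g x = ginf x + gbar x + q"
    and F_ext: "continuous_on UNIV F" "\<And>x. x \<in> C \<Longrightarrow> F x = finf x + fbar x - fbar 0"
    and Finf_ext: "continuous_on UNIV Finf" "\<And>x. x \<in> C \<Longrightarrow> Finf x = finf x"
    and g_vimage: "g -` C \<subseteq> C"
    and gbar_C: "\<forall>\<^sub>F x in at_infinity. gbar x + q \<in> C"
    and d_ex: "\<exists>d \<in> interior (dual_cone (recession_cone K)).
      (SOL C finf ginf (recession_cone K) = {0} \<and>
       SOL C (\<lambda>x. finf x + fbar x - fbar 0 + d) g (recession_cone K) = {0} \<and>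
       (\<exists>\<Omega>. \<Omega> \<noteq> {} \<and> bounded \<Omega> \<and> open \<Omega> \<and>
         (\<forall>x\<in>\<Omega>. ereal (dist (F x) (g x)) < set_dist d (frontier (dual_cone (recession_cone K)))) \<and>
         brouwer_degree g \<Omega> 0 \<noteq> 0))
      \<or>
      (SOL C finf ginf (recession_cone K) = {0} \<and>
       SOL C (\<lambda>x. finf x + d) ginf (recession_cone K) = {0} \<and>
       (\<exists>\<Omega>. \<Omega> \<noteq> {} \<and> bounded \<Omega> \<and> open \<Omega> \<and>
         (\<forall>x\<in>\<Omega>. ereal (dist (Finf x) (ginf x)) < set_dist d (frontier (dual_cone (recession_cone K)))) \<and>
         brouwer_degree ginf \<Omega> 0 \<noteq> 0))"
  shows "SOL C f g K \<noteq> {} \<and> compact (SOL C f g K) \<and>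
         WHGCP C f g (recession_cone K) \<noteq> {} \<and> compact (WHGCP C f g (recession_cone K))"
proof -
  let ?R = "recession_cone K"
  note K3 = K(2,3,1)
  note R = closed_recession_cone[OF K3] convex_recession_cone[OF K3] cone_recession_cone[OF K3]
  have Rne: "?R \<noteq> {}" using zero_in_recession_cone[OF K3] by blast
  have RC: "?R \<subseteq> C" by (rule recession_cone_subset[OF K3 C(1,3) K(4)])
  have C_add: "x + y \<in> C" if "x \<in> C" "y \<in> C" for x y
    using that C convex_cone[of C] by simp
  have C0: "0 \<in> C" using RC zero_in_recession_cone[OF K3] by blast
  obtain d where d: "d \<in> dual_cone ?R" and
    d_cases: "(SOL C finf ginf ?R = {0} \<and>
       SOL C (\<lambda>x. finf x + fbar x - fbar 0 + d) g ?R = {0} \<and>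
       (\<exists>\<Omega>. bounded \<Omega> \<and> open \<Omega> \<and>
         (\<forall>x\<in>\<Omega>. ereal (dist (F x) (g x)) < set_dist d (frontier (dual_cone ?R))) \<and>
         brouwer_degree g \<Omega> 0 \<noteq> 0))
      \<or>
      (SOL C finf ginf ?R = {0} \<and>
       SOL C (\<lambda>x. finf x + d) ginf ?R = {0} \<and>
       (\<exists>\<Omega>. bounded \<Omega> \<and> open \<Omega> \<and>
         (\<forall>x\<in>\<Omega>. ereal (dist (Finf x) (ginf x)) < set_dist d (frontier (dual_cone ?R))) \<and>
         brouwer_degree ginf \<Omega> 0 \<noteq> 0))"
    using d_ex interior_subset by blast
  \<comment> \<open>Adding \<open>fbar 0 + p\<close> undoes the normalisation of \<open>F\<close>,
    giving a continuous extension of \<open>f\<close>.\<close>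
  define F1 where "F1 x = F x + (fbar 0 + p)" for x
  have F1: "F1 x = f x" if "x \<in> C" for x using that by (simp add: F1_def F_ext f_eq)
  have F1_cont: "continuous_on UNIV F1" unfolding F1_def by (intro continuous_intros F_ext)
  have F1_wh: "weakly_homogeneous_on C \<delta>\<^sub>1 F1 finf"
    by (rule weakly_homogeneous_on_add_const[OF f_wh, of _ 0]) (simp add: F1)
  \<comment> \<open>The vector is \<open>d\<close> displaced by \<open>\<phi> x - \<psi> x\<close>,
    which is shorter than the distance from \<open>d\<close> to the frontier.\<close>
  have dual: "\<phi> x + d - \<psi> x \<in> dual_cone ?R"
    if "ereal (dist (\<phi> x) (\<psi> x)) < set_dist d (frontier (dual_cone ?R))" for \<phi> \<psi> :: "'a \<Rightarrow> 'a" and x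
    using add_in_closed_set[OF d closed_dual_cone, of "\<phi> x - \<psi> x"] that
    by (simp add: dist_norm algebra_simps)
  have ginf_hom: "ginf (l *\<^sub>R x) = (l powr \<delta>\<^sub>2) *\<^sub>R ginf x" if "l > 0" for l x
    using g_wh that by (simp add: weakly_homogeneous_on_def pos_homogeneous_on_def)
  obtain r where r: "\<And>x. r \<le> norm x \<Longrightarrow> gbar x + q \<in> C"
    using gbar_C unfolding eventually_at_infinity by blast
  \<comment> \<open>Adding \<open>(1 - t) (gbar x + q)\<close>, which lies in \<open>C\<close> for
    large \<open>x\<close>, turns the combination into \<open>g x\<close>; then
    \<open>g_vimage\<close> applies.\<close>
  have esc: "x \<in> C" if "(1 - t) *\<^sub>R ginf x + t *\<^sub>R g x \<in> C" "r \<le> norm x" "t \<in> {0..1}" for x t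
  proof -
    have "(1 - t) *\<^sub>R (gbar x + q) \<in> C" using r that C(3) by (intro mem_cone) auto
    with that(1) have "((1 - t) *\<^sub>R ginf x + t *\<^sub>R g x) + (1 - t) *\<^sub>R (gbar x + q) \<in> C"
      by (rule C_add)
    also have "((1 - t) *\<^sub>R ginf x + t *\<^sub>R g x) + (1 - t) *\<^sub>R (gbar x + q) = g x"
      by (simp add: g_eq algebra_simps)
    finally show ?thesis using g_vimage by blast
  qed
  have ginf_vimage: "ginf -` C \<subseteq> C"
  proof
    fix x assume x: "x \<in> ginf -` C"
    show "x \<in> C"
    proof (cases "x = 0")
      case False
      \<comment> \<open>By homogeneity \<open>x\<close> may be scaled until its norm reaches
        \<open>r\<close>, where \<open>esc\<close> with \<open>t = 0\<close> applies, and then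
        scaled back. The lower bound 1 keeps \<open>l\<close> positive for any
        \<open>r\<close>.\<close>
      define l where "l = max 1 (r / norm x)"
      have "r / norm x * norm x \<le> l * norm x" by (intro mult_right_mono) (auto simp: l_def)
      then have l: "l > 0" "r \<le> norm (l *\<^sub>R x)"
        using False by (auto simp: l_def)
      have "ginf (l *\<^sub>R x) \<in> C" using x l(1) C(3) by (simp add: ginf_hom mem_cone)
      then have "l *\<^sub>R x \<in> C" using esc[of 0 "l *\<^sub>R x"] l(2) by simp
      then have "inverse l *\<^sub>R (l *\<^sub>R x) \<in> C" by (rule mem_cone[OF C(3)]) (use l in simp)
      then show ?thesis using l(1) by simp
    qed (simp add: C0)
  qed
  \<comment> \<open>\<open>S\<close> will be \<open>K\<close> or its recession cone; all hypotheses
    on the limit problem depend only on the common recession cone.\<close>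
  have key: "SOL C f g S \<noteq> {} \<and> compact (SOL C f g S)"
    if S: "closed S" "convex S" "S \<noteq> {}" "S \<subseteq> C" and rec: "recession_cone S = ?R" for S
  proof -
    have "SOL C F1 g S \<noteq> {} \<and> compact (SOL C F1 g S)"
      using d_cases
    proof (elim disjE conjE exE)
      fix \<Omega>
      assume inf: "SOL C finf ginf ?R = {0}"
        and start: "SOL C (\<lambda>x. finf x + fbar x - fbar 0 + d) g ?R = {0}"
        and \<Omega>: "bounded \<Omega>" "open \<Omega>"
        and dist: "\<forall>x\<in>\<Omega>. ereal (dist (F x) (g x)) < set_dist d (frontier (dual_cone ?R))"
        and deg: "brouwer_degree g \<Omega> 0 \<noteq> 0"
      show ?thesis
      proof (rule SOL_nonempty_compact[OF C S, where ?F0.0 = "\<lambda>x. F x + d" and ?g0.0 = g])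
        show "weakly_homogeneous_on C \<delta>\<^sub>1 (\<lambda>x. F x + d) finf"
          \<comment> \<open>On \<open>C\<close>, \<open>F + d\<close> differs from \<open>f\<close>
            by exactly \<open>d - fbar 0 - p\<close>.\<close>
          by (rule weakly_homogeneous_on_add_const[OF f_wh, of _ "d - fbar 0 - p"])
             (simp add: F_ext f_eq)
        show "SOL C (\<lambda>x. F x + d) g (recession_cone S) = {0}"
          unfolding rec start[symmetric] by (rule SOL_cong) (simp add: F_ext)
        \<comment> \<open>Both ends are \<open>g\<close>, so the combination is \<open>g x\<close>
          and \<open>g_vimage\<close> suffices for every \<open>x\<close>.\<close>
        show "\<forall>\<^sub>F x in at_infinity. \<forall>t\<in>{0..1}. (1 - t) *\<^sub>R g x + t *\<^sub>R g x \<in> C \<longrightarrow> x \<in> C"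
          using g_vimage by (intro always_eventually) (auto simp flip: scaleR_left_distrib)
      qed (use F1_wh F1_cont g_wh inf g_vimage \<Omega> deg rec dual dist F_ext(1)
           in \<open>auto intro!: continuous_intros\<close>)
    next
      fix \<Omega>
      assume inf: "SOL C finf ginf ?R = {0}"
        and start: "SOL C (\<lambda>x. finf x + d) ginf ?R = {0}"
        and \<Omega>: "bounded \<Omega>" "open \<Omega>"
        and dist: "\<forall>x\<in>\<Omega>. ereal (dist (Finf x) (ginf x)) < set_dist d (frontier (dual_cone ?R))"
        and deg: "brouwer_degree ginf \<Omega> 0 \<noteq> 0"
      show ?thesis
      \<comment> \<open>Here \<open>g\<close> is deformed too, from its leading term, so
        \<open>esc\<close> and \<open>ginf_vimage\<close> are needed.\<close>
      proof (rule SOL_nonempty_compact[OF C S, where ?F0.0 = "\<lambda>x. Finf x + d" and ?g0.0 = ginf])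
        show "weakly_homogeneous_on C \<delta>\<^sub>1 (\<lambda>x. Finf x + d) finf"
          by (rule weakly_homogeneous_on_add_const[OF weakly_homogeneous_on_leading_term[OF f_wh], of _ d])
             (simp add: Finf_ext)
        show "weakly_homogeneous_on UNIV \<delta>\<^sub>2 ginf ginf"
          by (rule weakly_homogeneous_on_leading_term[OF g_wh])
        show "SOL C (\<lambda>x. Finf x + d) ginf (recession_cone S) = {0}"
          unfolding rec start[symmetric] by (rule SOL_cong) (simp add: Finf_ext)
        show "\<forall>\<^sub>F x in at_infinity. \<forall>t\<in>{0..1}. (1 - t) *\<^sub>R ginf x + t *\<^sub>R g x \<in> C \<longrightarrow> x \<in> C"
          unfolding eventually_at_infinity using esc by blast
      qed (use F1_wh F1_cont g_wh inf g_vimage ginf_vimage \<Omega> deg rec dual dist Finf_ext(1)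
           in \<open>auto intro!: continuous_intros\<close>)
    qed
    moreover have "SOL C F1 g S = SOL C f g S" by (rule SOL_cong) (rule F1)
    ultimately show ?thesis by simp
  qed
  show ?thesis
    using key[OF K3 K(4)] key[OF R(1,2) Rne RC recession_cone_of_cone[OF R Rne]] WHGCP_eq_SOL[OF R(3,2)]
    by simp
qed

end
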